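(* Let $N,M\in\mathbb{N}$, $p\in(1,2)$, $\sigma_{\mathrm{rp}}(z)=\operatorname{sign}(z)|z|^{2/p}$ for $z\in\mathbb{R}$ (acting entry-wise on vectors), $A\in\mathbb{R}^{M\times N}$, $y\in\operatorname{im}(A)$ (the column span of $A$), and $\alpha>0$. Let $L:\mathbb{R}^M\times\mathbb{R}^M\to\mathbb{R}$ be continuously differentiable, convex in its first argument, with $\min L=0$ and such that $L(z,z')=\min L$ if and only if $z=z'$. Define $\mathcal{L}(z)=L(A\sigma_{\mathrm{rp}}(z),y)$ for $z\in\mathbb{R}^N$. Let $T\in\mathbb{R}_{>0}\cup\{+\infty\}$ and let $w:[0,T)\to\mathbb{R}^N$ be any regular solution of $$w'(t)=-\nabla\mathcal{L}(w(t)),\qquad w(0)=w_0:=\sigma_{\mathrm{rp}}^{-1}(\alpha\mathbf{1}).$$ Then, if $T<\infty$, $w$ is not maximal. Furthermore, if $T=\infty$ or $w$ can be extended to a regular solution $w:[0,\infty)\to\mathbb{R}^N$, then $w_{\infty,\alpha}:=\lim_{t\to\infty}w(t)\in\mathbb{R}^N$ exists and is a global minimizer of $\mathcal{L}$. Moreover, in this case, set $\widetilde w_{\infty,\alpha}:=\sigma_{\mathrm{rp}}(w_{\infty,\alpha})$ and $$\mu:=\min_{\widetilde z\in\mathbb{R}^N,\ L(A\widetilde z,y)=0}\|\widetilde z\|_p,$$ and assume that $$\alpha\le\frac{1}{2^{1/(p-1)}N^{1/p}}\,\mu .$$ Then $$\|\widetilde w_{\infty,\alpha}\|_p\le\left(1+4N^{1-1/p}\left(\frac{\alpha}{\mu}\right)^{p-1}\right)\cdot\mu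 .$$
   Context: Here $\mathbf 1\in\mathbb{R}^N$ is the all-ones vector and $\|z\|_p=(\sum_i|z_i|^p)^{1/p}$. A solution $w:[0,T)\to\mathbb{R}^N$ of the gradient flow $w'(t)=-\nabla\mathcal{L}(w(t))$, $w(0)=w_0$ (solutions need not be unique) is called regular if the set $\{t\in[0,T):\sigma_{\mathrm{rp}}'(w(t)_i)=0\text{ for some }i\in\{1,\dots,N\}\}$ is finite. For $T<\infty$ it is called maximal if for every $\varepsilon>0$ and every solution $\bar w:[0,T+\varepsilon)\to\mathbb{R}^N$ of the same initial value problem one has $\bar w|_{[0,T)}\neq w$. *)

theory Defs
  imports "HOL-Analysis.Analysis"
begin

definition sigma_rp :: "real \<Rightarrow> real \<Rightarrow> real" where
  "sigma_rp p z = sgn z * \<bar>z\<bar> powr (2 / p)"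

definition sigma_rp_vec :: "real \<Rightarrow> real ^ 'n \<Rightarrow> real ^ 'n" where
  "sigma_rp_vec p z = (\<chi> i. sigma_rp p (z $ i))"

definition pnorm :: "real \<Rightarrow> real ^ 'n \<Rightarrow> real" where
  "pnorm p z = (\<Sum>i\<in>UNIV. \<bar>z $ i\<bar> powr p) powr (1 / p)"

definition continuously_differentiable ::
    "('a::real_normed_vector \<Rightarrow> 'b::real_normed_vector) \<Rightarrow> bool" where
  "continuously_differentiable f \<longleftrightarrow>
     (\<exists>f' :: 'a \<Rightarrow> 'a \<Rightarrow>\<^sub>L 'b.
        (\<forall>x. (f has_derivative blinfun_apply (f' x)) (at x)) \<and> continuous_on UNIV f')"

(* Only meaningful where f is differentiable. *)
definition gradient :: "('a::real_inner \<Rightarrow> real) \<Rightarrow> 'a \<Rightarrow> 'a" where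
  "gradient f x = (THE g. GDERIV f x :> g)"

(* The interval [0,T). Functions on it are total functions on the reals whose values
   off the interval are never inspected. *)
definition time_interval :: "ereal \<Rightarrow> real set" where
  "time_interval T = {t. 0 \<le> t \<and> ereal t < T}"

(* The derivative within the interval is the one-sided one at t = 0. *)
definition gradient_flow_solution ::
    "('a::real_inner \<Rightarrow> real) \<Rightarrow> 'a \<Rightarrow> ereal \<Rightarrow> (real \<Rightarrow> 'a) \<Rightarrow> bool" where
  "gradient_flow_solution f w0 T w \<longleftrightarrow>
     w 0 = w0 \<and>
     (\<forall>t\<in>time_interval T.
        (w has_vector_derivative - gradient f (w t)) (at t within time_interval T))"

definition maximal_solution ::
    "('a::real_inner \<Rightarrow> real) \<Rightarrow> 'a \<Rightarrow> real \<Rightarrow> (real \<Rightarrow> 'a) \<Rightarrow> bool" where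
  "maximal_solution f w0 T w \<longleftrightarrow>
     gradient_flow_solution f w0 (ereal T) w \<and>
     (\<forall>\<epsilon>>0. \<forall>w'. gradient_flow_solution f w0 (ereal (T + \<epsilon>)) w' \<longrightarrow>
        \<not> (\<forall>t\<in>time_interval (ereal T). w' t = w t))"

definition rp_loss ::
    "real \<Rightarrow> real ^ 'n ^ 'm \<Rightarrow> ((real ^ 'm) \<times> (real ^ 'm) \<Rightarrow> real) \<Rightarrow> real ^ 'm \<Rightarrow> real ^ 'n \<Rightarrow> real" where
  "rp_loss p A L y z = L (A *v sigma_rp_vec p z, y)"

definition regular_solution ::
    "real \<Rightarrow> (real ^ 'n \<Rightarrow> real) \<Rightarrow> real ^ 'n \<Rightarrow> ereal \<Rightarrow> (real \<Rightarrow> real ^ 'n) \<Rightarrow> bool" where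
  "regular_solution p f w0 T w \<longleftrightarrow>
     gradient_flow_solution f w0 T w \<and>
     finite {t \<in> time_interval T. \<exists>i. deriv (sigma_rp p) (w t $ i) = 0}"

definition min_pnorm ::
    "real \<Rightarrow> real ^ 'n ^ 'm \<Rightarrow> ((real ^ 'm) \<times> (real ^ 'm) \<Rightarrow> real) \<Rightarrow> real ^ 'm \<Rightarrow> real" where
  "min_pnorm p A L y = (LEAST r. r \<in> pnorm p ` {z. L (A *v z, y) = 0})"

end

theory Submission
  imports Defs "HOL-Complex_Analysis.Great_Picard"
begin

text \<open>Put \<open>u = sigma_rp_vec p w\<close>. As long as no entry vanishes, the gradient flow in \<open>w\<close> is a mirror flow in
\<open>u\<close>: the mirror coordinates \<open>sgn (u $ i) * \<bar>u $ i\<bar> powr (p - 1)\<close> move with velocity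
\<open>- rate *\<^sub>R (transpose A *v g)\<close>, where \<open>g\<close> is the gradient of the loss at the prediction \<open>A *v u\<close> and
\<open>rate = 4 * (p - 1) / p\<^sup>2\<close>. The natural Lyapunov function is therefore the Bregman divergence of
\<open>\<Sum>i. \<bar>z $ i\<bar> powr p / p\<close> from the current point to a vector \<open>z\<close>. Its time derivative is
\<open>rate * (g \<bullet> (A *v z - A *v u))\<close>. Regularity leaves only finitely many times at which this
computation breaks down, and the divergence is continuous there, so the identity holds in integrated
form (\<open>divergence_along_flow\<close>). Three consequences carry the theorem.

If \<open>A *v z = y\<close>, convexity makes the derivative at most \<open>- rate\<close> times the loss. Hence the divergence
decreases, and since its sublevel sets are bounded, so is the trajectory. A bounded solution on a
finite interval extends beyond it; because the gradient is merely continuous, the extension comes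
from Peano's existence theorem (\<open>peano_existence\<close>, \<open>bounded_solution_extends\<close>).

On an infinite interval the nonnegative divergence cannot decrease forever at a fixed rate, so the
loss gets arbitrarily small at late times. Some cluster point then interpolates \<open>y\<close>, and the
divergence from this very point forces convergence (\<open>regular_solution_converges\<close>).

The derivative depends on \<open>z\<close> only through \<open>A *v z\<close>, so the difference of the divergences of two
interpolating vectors is constant in time. In the limit, the flow selects the interpolating vector
with the smallest divergence from the initial point. That initial point has all mirror coordinates
equal to the small number \<open>\<alpha> powr (p - 1)\<close>, so up to constants the divergence from it is nearly
the \<open>p\<close>-th power of the norm.
Hoelder's and Bernoulli's inequalities make this quantitative
(\<open>pnorm_estimate_of_divergence_le\<close>).\<close>

section \<open>Existence and extension of solutions for continuous vector fields\<close>

lemma indefinite_integral_lipschitz: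
  fixes f :: "real \<Rightarrow> 'a::euclidean_space"
  assumes cont: "continuous_on UNIV f" and bound: "\<And>s. norm (f s) \<le> B"
  shows "norm (integral {0..t} f - integral {0..s} f) \<le> B * \<bar>t - s\<bar>"
proof -
  have int: "f integrable_on {a..b}" for a b
    by (meson cont continuous_on_subset integrable_continuous_real subset_UNIV)
  have B0: "0 \<le> B" using bound[of 0] norm_ge_zero order_trans by blast
  have small: "norm (integral {a..b} f) \<le> B * (b - a)" if "a \<le> b" for a b
    using integral_bound[OF that, of f B] cont bound continuous_on_subset by blast
  have main: "norm (integral {0..t} f - integral {0..s} f) \<le> B * (t - s)" if "s \<le> t" for s t
  proof (cases "0 \<le> s")
    case True
    have "integral {0..t} f - integral {0..s} f = integral {s..t} f"
      using Henstock_Kurzweil_Integration.integral_combine[OF True that int] by (simp add: algebra_simps)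
    then show ?thesis using small[OF that] by simp
  next
    case False
    then have "integral {0..s} f = 0" by simp
    moreover have "norm (integral {0..t} f) \<le> B * (t - s)"
    proof (cases "0 \<le> t")
      case True
      have "norm (integral {0..t} f) \<le> B * (t - 0)" by (rule small[OF True])
      also have "\<dots> \<le> B * (t - s)" using B0 False by (intro mult_left_mono) auto
      finally show ?thesis .
    next
      case False
      then show ?thesis using B0 that by simp
    qed
    ultimately show ?thesis by simp
  qed
  show ?thesis
  proof (cases "s \<le> t")
    case True then show ?thesis using main[of s t] by simp
  next
    case False then show ?thesis using main[of t s] by (simp add: norm_minus_commute)
  qed
qed

text \<open>With a delay \<open>h\<close> the right-hand side at time \<open>s\<close> involves the solution only up to \<open>s - h\<close>, so the
Picard iterates, started from a constant function, become stationary on \<open>(-\<infinity>, k h]\<close> after \<open>k\<close>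
steps; this replaces the contraction argument available for Lipschitz fields. The history for
\<open>t \<le> 0\<close> is the constant \<open>x0\<close>, because the integral over the empty interval \<open>{0..t}\<close> is zero.\<close>

lemma delay_equation_solution:
  fixes G :: "'a::euclidean_space \<Rightarrow> 'a"
  assumes contG: "continuous_on UNIV G" and bound: "\<And>z. norm (G z) \<le> B" and h: "0 < h"
  obtains X where "\<And>s t. norm (X t - X s) \<le> B * \<bar>t - s\<bar>"
    "\<And>t. t \<le> b \<Longrightarrow> X t = x0 + integral {0..t} (\<lambda>s. G (X (s - h)))"
proof -
  define step where "step Y t = x0 + integral {0..t} (\<lambda>s. G (Y (s - h)))" for Y t
  define X where "X = (\<lambda>k. (step ^^ k) (\<lambda>_. x0))"
  have X0: "X 0 = (\<lambda>_. x0)" and XSuc: "X (Suc k) = step (X k)" for k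
    by (simp_all add: X_def)
  have B0: "0 \<le> B" using bound norm_ge_zero order_trans by blast
  have lip: "norm (X k t - X k s) \<le> B * \<bar>t - s\<bar>" for k t s
  proof (induction k arbitrary: s t)
    case 0 then show ?case using B0 by (simp add: X0)
  next
    case (Suc k)
    have "continuous_on UNIV (X k)"
    proof (rule lipschitz_on_continuous_on)
      show "B-lipschitz_on UNIV (X k)"
        using Suc B0 by (intro lipschitz_onI) (auto simp: dist_norm)
    qed
    then have "continuous_on UNIV (\<lambda>s. G (X k (s - h)))"
      using continuous_on_compose2[OF contG, of UNIV "\<lambda>s. X k (s - h)"]
        continuous_on_compose2[of UNIV "X k" UNIV "\<lambda>s. s - h"]
      by (simp add: continuous_intros)
    from indefinite_integral_lipschitz[OF this bound, of t s]
    show ?case by (simp add: XSuc step_def)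
  qed
  have stable: "X (Suc k) t = X k t" if "t \<le> real k * h" for k t
    using that
  proof (induction k arbitrary: t)
    case 0
    then show ?case by (cases "t = 0") (auto simp: X0 XSuc step_def)
  next
    case (Suc k)
    have "integral {0..t} (\<lambda>s. G (X (Suc k) (s - h))) = integral {0..t} (\<lambda>s. G (X k (s - h)))"
      using Suc.prems by (intro integral_cong) (simp add: Suc.IH algebra_simps)
    then show ?case by (simp add: XSuc[of "Suc k"] XSuc[of k] step_def)
  qed
  obtain K where K: "b \<le> real K * h"
    using reals_Archimedean3[OF h] less_imp_le by blast
  show ?thesis
  proof
    show "norm (X K t - X K s) \<le> B * \<bar>t - s\<bar>" for s t by (rule lip)
    show "X K t = x0 + integral {0..t} (\<lambda>s. G (X K (s - h)))" if "t \<le> b" for t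
      using stable[of t K] that K by (simp add: XSuc step_def)
  qed
qed

text \<open>Tonelli's argument: solutions of the equation with delay \<open>1/(n+1)\<close> share the Lipschitz constant \<open>B\<close>,
so a subsequence converges uniformly by Arzela--Ascoli, and the integral equation passes to the
limit. The field is first frozen outside a unit ball around \<open>x0\<close>, which makes it bounded; the limit
does not leave the ball before time \<open>1/B\<close>.\<close>

theorem peano_existence:
  fixes F :: "'a::euclidean_space \<Rightarrow> 'a"
  assumes contF: "continuous_on UNIV F"
  obtains \<delta> x where "0 < \<delta>" "x 0 = x0"
    "\<And>t. t \<in> {0..\<delta>} \<Longrightarrow> (x has_vector_derivative F (x t)) (at t within {0..\<delta>})"
proof -
  define C where "C = cball x0 1"
  have C: "convex C" "closed C" "C \<noteq> {}" "compact C" by (auto simp: C_def)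
  have "compact (F ` C)"
    using contF C continuous_on_subset by (blast intro: compact_continuous_image)
  then obtain B where B: "0 < B" "\<And>z. z \<in> C \<Longrightarrow> norm (F z) \<le> B"
    using compact_imp_bounded[of "F ` C"] unfolding bounded_pos by blast
  define G where "G z = F (closest_point C z)" for z
  have contG: "continuous_on UNIV G"
    unfolding G_def
    by (rule continuous_on_compose2[OF contF continuous_on_closest_point[OF C(1-3)]]) auto
  have boundG: "norm (G z) \<le> B" for z
    unfolding G_def using C by (intro B closest_point_in_set)
  have GF: "G z = F z" if "z \<in> C" for z
    using that by (simp add: G_def closest_point_self)
  define \<delta> where "\<delta> = 1 / B"
  have \<delta>: "0 < \<delta>" "B * \<delta> = 1" using B by (auto simp: \<delta>_def)
  define h where "h n = inverse (real (Suc n))" for n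
  have h: "0 < h n" for n by (simp add: h_def)
  have "\<forall>n. \<exists>X. (\<forall>s t. norm (X t - X s) \<le> B * \<bar>t - s\<bar>) \<and>
     (\<forall>t\<le>\<delta>. X t = x0 + integral {0..t} (\<lambda>s. G (X (s - h n))))"
    using delay_equation_solution[OF contG boundG h] by metis
  then obtain X where lip: "\<And>n s t. norm (X n t - X n s) \<le> B * \<bar>t - s\<bar>"
    and eq: "\<And>n t. t \<le> \<delta> \<Longrightarrow> X n t = x0 + integral {0..t} (\<lambda>s. G (X n (s - h n)))"
    by metis
  have contX: "continuous_on UNIV (X n)" for n
  proof (rule lipschitz_on_continuous_on)
    show "B-lipschitz_on UNIV (X n)"
      using lip B by (intro lipschitz_onI) (auto simp: dist_norm)
  qed
  have X0: "X n 0 = x0" for n using eq[of 0 n] \<delta> by simp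
  obtain x k where contx: "continuous_on {0..\<delta>} x" and k: "strict_mono (k :: nat \<Rightarrow> nat)"
    and conv: "\<And>e. 0 < e \<Longrightarrow> \<exists>N. \<forall>n s. n \<ge> N \<and> s \<in> {0..\<delta>} \<longrightarrow> norm (X (k n) s - x s) < e"
  proof (rule Arzela_Ascoli[of "{0..\<delta>}" X "norm x0 + 1"])
    show "norm (X n t) \<le> norm x0 + 1" if "t \<in> {0..\<delta>}" for n t
    proof -
      have "norm (X n t - x0) \<le> B * t" using lip[of n t 0] that by (simp add: X0)
      also have "\<dots> \<le> B * \<delta>" using that B by (intro mult_left_mono) auto
      finally show ?thesis using \<delta> norm_triangle_ineq2[of "X n t" x0] by simp
    qed
    show "\<exists>d>0. \<forall>n t. t \<in> {0..\<delta>} \<and> norm (s - t) < d \<longrightarrow> norm (X n s - X n t) < e"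
      if "0 < e" for s e
    proof (intro exI conjI allI impI)
      show "0 < e / B" using that B by simp
      fix n t assume "t \<in> {0..\<delta>} \<and> norm (s - t) < e / B"
      then have "B * \<bar>s - t\<bar> < e" using B by (simp add: field_simps)
      then show "norm (X n s - X n t) < e" using lip[where n=n and t=s and s=t] by simp
    qed
  qed auto
  have lim: "(\<lambda>n. X (k n) s) \<longlonglongrightarrow> x s" if "s \<in> {0..\<delta>}" for s
    unfolding LIMSEQ_iff using conv that by blast
  have hlim: "(\<lambda>n. h (k n)) \<longlonglongrightarrow> 0"
    using LIMSEQ_subseq_LIMSEQ[OF LIMSEQ_inverse_real_of_nat k] by (simp add: h_def o_def)
  have lim_delayed: "(\<lambda>n. X (k n) (s - h (k n))) \<longlonglongrightarrow> x s" if "s \<in> {0..\<delta>}" for s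
  proof -
    have "(\<lambda>n. B * h (k n)) \<longlonglongrightarrow> 0"
      using tendsto_mult[OF tendsto_const hlim, of B] by simp
    then have "(\<lambda>n. X (k n) (s - h (k n)) - X (k n) s) \<longlonglongrightarrow> 0"
    proof (rule Lim_null_comparison[rotated])
      show "\<forall>\<^sub>F n in sequentially. norm (X (k n) (s - h (k n)) - X (k n) s) \<le> B * h (k n)"
      proof (rule always_eventually, rule allI)
        fix n
        show "norm (X (k n) (s - h (k n)) - X (k n) s) \<le> B * h (k n)"
          using lip[of "k n" "s - h (k n)" s] h[of "k n"] by simp
      qed
    qed
    from tendsto_add[OF this lim[OF that]] show ?thesis by simp
  qed
  have integral_eq: "x t = x0 + integral {0..t} (\<lambda>s. G (x s))" if t: "t \<in> {0..\<delta>}" for t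
  proof -
    have "(\<lambda>n. integral {0..t} (\<lambda>s. G (X (k n) (s - h (k n))))) \<longlonglongrightarrow> integral {0..t} (\<lambda>s. G (x s))"
    proof (rule dominated_convergence(2)[where h="\<lambda>_. B"])
      show "(\<lambda>s. G (X (k n) (s - h (k n)))) integrable_on {0..t}" for n
      proof (rule integrable_continuous_real)
        have "continuous_on {0..t} (\<lambda>s. X (k n) (s - h (k n)))"
          by (rule continuous_on_compose2[OF contX]) (auto intro!: continuous_intros)
        then show "continuous_on {0..t} (\<lambda>s. G (X (k n) (s - h (k n))))"
          by (rule continuous_on_compose2[OF contG]) auto
      qed
      show "(\<lambda>n. G (X (k n) (s - h (k n)))) \<longlonglongrightarrow> G (x s)" if "s \<in> {0..t}" for s
        using contG lim_delayed[of s] that t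
        by (auto simp: continuous_on_eq_continuous_at intro!: isCont_tendsto_compose[of _ G])
    qed (auto simp: boundG)
    then have "(\<lambda>n. X (k n) t) \<longlonglongrightarrow> x0 + integral {0..t} (\<lambda>s. G (x s))"
      using t by (simp add: eq tendsto_add)
    then show ?thesis using lim[OF t] LIMSEQ_unique by blast
  qed
  have contGx: "continuous_on {0..\<delta>} (\<lambda>s. G (x s))"
    by (rule continuous_on_compose2[OF contG contx]) auto
  have inC: "x t \<in> C" if t: "t \<in> {0..\<delta>}" for t
  proof -
    have "norm (integral {0..t} (\<lambda>s. G (x s))) \<le> B * (t - 0)"
      using t by (intro integral_bound) (auto intro: continuous_on_subset[OF contGx] boundG)
    also have "\<dots> \<le> B * \<delta>" using t B by (intro mult_left_mono) auto
    finally show ?thesis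
      using \<delta> integral_eq[OF t] by (simp add: C_def dist_norm)
  qed
  show ?thesis
  proof
    show "x 0 = x0" using integral_eq[of 0] \<delta> by simp
    show "(x has_vector_derivative F (x t)) (at t within {0..\<delta>})" if t: "t \<in> {0..\<delta>}" for t
    proof (rule has_vector_derivative_transform[OF t])
      show "((\<lambda>t. x0 + integral {0..t} (\<lambda>s. G (x s))) has_vector_derivative F (x t)) (at t within {0..\<delta>})"
        using has_vector_derivative_add[OF has_vector_derivative_const integral_has_vector_derivative[OF contGx t], of x0]
        by (simp only: GF[OF inC[OF t]] add_0)
    qed (simp add: integral_eq)
  qed (rule \<delta>)
qed

lemma has_vector_derivative_at_interior:
  assumes "(x has_vector_derivative d) (at t within S)" "open U" "t \<in> U" "U \<subseteq> S"
  shows "(x has_vector_derivative d) (at t)"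
  using has_vector_derivative_within_subset[OF assms(1,4)] at_within_open[OF assms(3,2)] by simp

text \<open>By the fundamental theorem of calculus with finitely many exceptions, \<open>x\<close> solves the integral
equation, whose right-hand side is differentiable everywhere. This removes the junction time when
two solutions are glued.\<close>

lemma solution_if_off_finite_set:
  fixes x :: "real \<Rightarrow> 'a::euclidean_space"
  assumes F: "continuous_on UNIV F" and x: "continuous_on {0..b} x" and S: "finite S"
    and der: "\<And>t. t \<in> {0<..<b} - S \<Longrightarrow> (x has_vector_derivative F (x t)) (at t)"
    and t: "t \<in> {0..b}"
  shows "(x has_vector_derivative F (x t)) (at t within {0..b})"
proof -
  have cont: "continuous_on {0..b} (\<lambda>s. F (x s))"
    by (rule continuous_on_compose2[OF F x]) simp
  have eq: "x s = x 0 + integral {0..s} (\<lambda>s. F (x s))" if s: "s \<in> {0..b}" for s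
  proof -
    have "((\<lambda>s. F (x s)) has_integral (x s - x 0)) {0..s}"
      by (rule fundamental_theorem_of_calculus_interior_strong[OF S])
        (use s in \<open>auto intro!: der continuous_on_subset[OF x]\<close>)
    then show ?thesis by (simp add: integral_unique)
  qed
  have der': "((\<lambda>s. x 0 + integral {0..s} (\<lambda>s. F (x s))) has_vector_derivative F (x t)) (at t within {0..b})"
    using has_vector_derivative_add[OF has_vector_derivative_const integral_has_vector_derivative[OF cont t], of "x 0"]
    by simp
  show ?thesis
    by (rule has_vector_derivative_transform[OF t eq der'])
qed

text \<open>A bounded solution has bounded velocity, so it is Lipschitz and has a limit at the end time \<open>T\<close>. From
this limit a Peano solution \<open>z\<close> starts, and gluing the two gives the extension.\<close>

lemma bounded_solution_extends:
  fixes x :: "real \<Rightarrow> 'a::euclidean_space"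
  assumes F: "continuous_on UNIV F" and T: "0 < T"
    and sol: "\<And>t. t \<in> {0..<T} \<Longrightarrow> (x has_vector_derivative F (x t)) (at t within {0..<T})"
    and bdd: "bounded (x ` {0..<T})"
  obtains \<delta> x' where "0 < \<delta>" "\<And>t. t \<in> {0..<T} \<Longrightarrow> x' t = x t"
    "\<And>t. t \<in> {0..T + \<delta>} \<Longrightarrow> (x' has_vector_derivative F (x' t)) (at t within {0..T + \<delta>})"
proof -
  have "compact (F ` closure (x ` {0..<T}))"
    using bdd F continuous_on_subset by (intro compact_continuous_image) (auto simp: compact_closure)
  then obtain B where B: "0 < B" "\<And>z. z \<in> closure (x ` {0..<T}) \<Longrightarrow> norm (F z) \<le> B"
    using compact_imp_bounded[of "F ` closure (x ` {0..<T})"] unfolding bounded_pos by blast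
  have lip: "norm (x t - x s) \<le> B * norm (t - s)" if "s \<in> {0..<T}" "t \<in> {0..<T}" for s t
  proof (rule differentiable_bound[of "{0..<T}" x "\<lambda>t h. h *\<^sub>R F (x t)"])
    fix r assume r: "r \<in> {0..<T}"
    then show "(x has_derivative (\<lambda>h. h *\<^sub>R F (x r))) (at r within {0..<T})"
      using sol by (simp add: has_vector_derivative_def)
    have "x r \<in> closure (x ` {0..<T})"
      using closure_subset[of "x ` {0..<T}"] r by (simp add: image_subset_iff)
    then have "norm (F (x r)) \<le> B" by (rule B(2))
    then show "onorm (\<lambda>h. h *\<^sub>R F (x r)) \<le> B"
      using B by (intro onorm_bound) (auto simp: mult.commute[of B] less_imp_le intro: mult_left_mono)
  qed (use that in auto)
  have "B-lipschitz_on {0..<T} x"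
    using B lip by (intro lipschitz_onI) (simp_all only: dist_norm less_imp_le)
  then obtain y where y: "uniformly_continuous_on (closure {0..<T}) y" "\<And>t. t \<in> {0..<T} \<Longrightarrow> x t = y t"
    using uniformly_continuous_on_extension_on_closure[OF lipschitz_on_uniformly_continuous] by metis
  have conty: "continuous_on {0..T} y"
    using uniformly_continuous_imp_continuous[OF y(1)] T by simp
  obtain \<delta> z where \<delta>: "0 < \<delta>" and z0: "z 0 = y T"
    and z: "\<And>t. t \<in> {0..\<delta>} \<Longrightarrow> (z has_vector_derivative F (z t)) (at t within {0..\<delta>})"
    using peano_existence[OF F] by metis
  define x' where "x' t = (if t \<le> T then y t else z (t - T))" for t
  have contz: "continuous_on {0..\<delta>} z"
    using z has_vector_derivative_continuous by (fastforce simp: continuous_on_eq_continuous_within)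
  have contx': "continuous_on {0..T + \<delta>} x'"
  proof -
    have "continuous_on {T..T + \<delta>} (\<lambda>t. z (t - T))"
      by (rule continuous_on_compose2[OF contz]) (auto intro!: continuous_intros)
    then have "continuous_on ({0..T} \<union> {T..T + \<delta>}) x'"
      unfolding x'_def using conty z0 by (intro continuous_on_If) auto
    then show ?thesis using T \<delta> by (simp add: ivl_disj_un_two_touch)
  qed
  have der: "(x' has_vector_derivative F (x' t)) (at t)" if t: "t \<in> {0<..<T + \<delta>} - {T}" for t
  proof (cases "t < T")
    case True
    then have tT: "t \<in> {0<..<T}" using t by simp
    have "(x has_vector_derivative F (x t)) (at t)"
      by (rule has_vector_derivative_at_interior[OF sol _ tT]) (use tT in auto)
    then have "(x' has_vector_derivative F (x t)) (at t)"
      by (rule has_vector_derivative_transform_within_open[where S = "{0<..<T}"])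
        (use tT y in \<open>auto simp: x'_def\<close>)
    then show ?thesis using tT y by (simp add: x'_def)
  next
    case False
    then have tT: "t \<in> {T<..<T + \<delta>}" using t by auto
    have "(z has_vector_derivative F (z (t - T))) (at (t - T))"
      by (rule has_vector_derivative_at_interior[OF z, of _ "{0<..<\<delta>}"]) (use tT in auto)
    moreover have "((\<lambda>t. t - T) has_vector_derivative 1) (at t)"
      by (auto intro!: derivative_eq_intros)
    ultimately have "((\<lambda>t. z (t - T)) has_vector_derivative F (z (t - T))) (at t)"
      using vector_diff_chain_at[of "\<lambda>t. t - T" 1 t z] by (simp add: o_def)
    then have "(x' has_vector_derivative F (z (t - T))) (at t)"
      by (rule has_vector_derivative_transform_within_open[where S = "{T<..<T + \<delta>}"])
        (use tT in \<open>auto simp: x'_def\<close>)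
    then show ?thesis using tT by (simp add: x'_def)
  qed
  show ?thesis
  proof
    show "x' t = x t" if "t \<in> {0..<T}" for t using that y by (simp add: x'_def)
    show "(x' has_vector_derivative F (x' t)) (at t within {0..T + \<delta>})" if "t \<in> {0..T + \<delta>}" for t
      by (rule solution_if_off_finite_set[OF F contx' _ der that, of "{T}"]) simp
  qed (rule \<delta>)
qed

section \<open>The tangent inequality for powers\<close>

text \<open>The tangent of \<open>\<bar>s\<bar>\<^sup>p\<close> at \<open>s = 1\<close>, obtained from Young's inequality for the product \<open>\<bar>s\<bar> * 1\<close>. Admitting
negative \<open>s\<close> later saves every case distinction on signs.\<close>

lemma abs_powr_tangent_at_one:
  fixes p s :: real
  assumes p: "1 < p"
  shows "1 + p * (s - 1) \<le> \<bar>s\<bar> powr p"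
proof -
  have "\<bar>s\<bar> * 1 \<le> \<bar>s\<bar> powr p / p + 1 powr (p / (p - 1)) / (p / (p - 1))"
    using p by (intro Youngs_inequality) (auto simp: field_simps)
  then have "\<bar>s\<bar> \<le> (\<bar>s\<bar> powr p + (p - 1)) / p"
    using p by (simp add: add_divide_distrib)
  then have "p * \<bar>s\<bar> \<le> \<bar>s\<bar> powr p + (p - 1)"
    using p by (simp add: pos_le_divide_eq mult.commute)
  moreover have "p * s \<le> p * \<bar>s\<bar>" using p by (intro mult_left_mono) auto
  ultimately show ?thesis by (simp add: algebra_simps)
qed

text \<open>Strict convexity without derivatives. Applied to \<open>r = sqrt s\<close> and squared, the tangent inequality
improves to \<open>s\<^sup>p \<ge> (1 + p (r - 1))\<^sup>2\<close>, and this exceeds \<open>1 + p (r\<^sup>2 - 1)\<close> by \<open>p (p - 1) (r - 1)\<^sup>2\<close>.\<close>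

lemma abs_powr_tangent_at_one_strict:
  fixes p s :: real
  assumes p: "1 < p" and eq: "\<bar>s\<bar> powr p = 1 + p * (s - 1)"
  shows "s = 1"
proof -
  have nn: "0 \<le> 1 + p * (s - 1)" using eq by (metis powr_ge_zero)
  have "0 \<le> s"
  proof (rule ccontr)
    assume "\<not> 0 \<le> s"
    then have "p * s < 0" using p by (simp add: mult_pos_neg)
    with nn p show False by (simp add: algebra_simps)
  qed
  define r where "r = sqrt s"
  have r: "0 \<le> r" "s = r\<^sup>2" using \<open>0 \<le> s\<close> by (auto simp: r_def)
  have sq: "s powr p = (r powr p)\<^sup>2"
    using r by (simp add: power2_eq_square powr_mult)
  \<comment> \<open>Squaring the inequality for \<open>r\<close> requires a nonnegative left-hand side. If it were negative,
    then \<open>r \<le> 1\<close>, hence \<open>s = r\<^sup>2 \<le> r\<close>, and \<open>1 + p (s - 1)\<close> would be negative as well.\<close>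
  have "0 \<le> 1 + p * (r - 1)"
  proof (rule ccontr)
    assume neg: "\<not> 0 \<le> 1 + p * (r - 1)"
    have "r \<le> 1"
    proof (rule ccontr)
      assume "\<not> r \<le> 1" then have "0 \<le> p * (r - 1)" using p by simp
      with neg show False by simp
    qed
    then have "r\<^sup>2 \<le> r" using r by (simp add: power2_eq_square mult_left_le)
    then have "p * (s - 1) \<le> p * (r - 1)" using p r by (intro mult_left_mono) auto
    with nn neg show False by simp
  qed
  moreover have "1 + p * (r - 1) \<le> r powr p"
    using abs_powr_tangent_at_one[OF p, of r] r by simp
  ultimately have "(1 + p * (r - 1))\<^sup>2 \<le> s powr p"
    unfolding sq by (intro power_mono)
  also have "\<dots> = 1 + p * (r\<^sup>2 - 1)" using eq \<open>0 \<le> s\<close> r by simp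
  finally have "p * (p - 1) * (r - 1)\<^sup>2 \<le> 0"
    by (simp add: power2_eq_square algebra_simps)
  then have "r = 1" using p by (simp add: mult_le_0_iff)
  then show ?thesis using r by simp
qed

text \<open>Hoelder's inequality against the all-ones vector: the tangent inequality at the mean \<open>m\<close> of the
\<open>\<bar>x $ i\<bar>\<close> is summed over \<open>i\<close>, and its linear terms cancel.\<close>

lemma sum_abs_le_powr:
  fixes x :: "real ^ 'n"
  assumes p: "1 < p"
  shows "(\<Sum>i\<in>UNIV. \<bar>x $ i\<bar>) \<le> real CARD('n) powr (1 - 1 / p) * (\<Sum>i\<in>UNIV. \<bar>x $ i\<bar> powr p) powr (1 / p)"
proof -
  define N where "N = real CARD('n)"
  have N: "0 < N" by (simp add: N_def)
  define m where "m = (\<Sum>i\<in>UNIV. \<bar>x $ i\<bar>) / N"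
  define S where "S = (\<Sum>i\<in>UNIV. \<bar>x $ i\<bar> powr p)"
  have sum_eq: "(\<Sum>i\<in>UNIV. \<bar>x $ i\<bar>) = N * m" using N by (simp add: m_def)
  have m0: "0 \<le> m" using N by (simp add: m_def sum_nonneg)
  have S0: "0 \<le> S" by (simp add: S_def sum_nonneg)
  show ?thesis
  proof (cases "m = 0")
    case True then show ?thesis unfolding sum_eq by simp
  next
    case False
    then have m: "0 < m" using m0 by simp
    have term_bound: "m powr p * (1 + p * (\<bar>x $ i\<bar> / m - 1)) \<le> \<bar>x $ i\<bar> powr p" for i
    proof -
      have "m powr p * (1 + p * (\<bar>x $ i\<bar> / m - 1)) \<le> m powr p * (\<bar>x $ i\<bar> / m) powr p"
        using abs_powr_tangent_at_one[OF p, of "\<bar>x $ i\<bar> / m"] m by (intro mult_left_mono) auto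
      also have "\<dots> = \<bar>x $ i\<bar> powr p"
        using m by (simp add: powr_divide)
      finally show ?thesis .
    qed
    have "(\<Sum>i\<in>(UNIV::'n set). 1 + p * (\<bar>x $ i\<bar> / m - 1)) = N"
      using m by (simp add: sum.distrib sum_subtractf sum_distrib_left[symmetric] sum_divide_distrib[symmetric] sum_eq
          right_diff_distrib N_def)
    then have "N * m powr p = (\<Sum>i\<in>(UNIV::'n set). m powr p * (1 + p * (\<bar>x $ i\<bar> / m - 1)))"
      by (simp add: sum_distrib_left[symmetric])
    also have "\<dots> \<le> S" unfolding S_def by (intro sum_mono term_bound)
    finally have "(N * m powr p) powr (1 / p) \<le> S powr (1 / p)"
      using N p by (intro powr_mono2) auto
    then have "N powr (1 / p) * m \<le> S powr (1 / p)"
      using N p m by (simp add: powr_mult powr_powr)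
    then have "N powr (1 - 1 / p) * (N powr (1 / p) * m) \<le> N powr (1 - 1 / p) * S powr (1 / p)"
      by (intro mult_left_mono) auto
    moreover have "N powr (1 - 1 / p) * (N powr (1 / p) * m) = N * m"
      using N by (simp add: mult.assoc[symmetric] powr_add[symmetric])
    ultimately show ?thesis unfolding sum_eq S_def N_def by linarith
  qed
qed

section \<open>Signed powers and the reparametrization\<close>

definition signed_powr :: "real \<Rightarrow> real \<Rightarrow> real" where
  "signed_powr a b = sgn b * \<bar>b\<bar> powr a"

lemma sigma_rp_eq_signed_powr: "sigma_rp p = signed_powr (2 / p)"
  by (simp add: sigma_rp_def signed_powr_def fun_eq_iff)

lemma signed_powr_0 [simp]: "signed_powr a 0 = 0"
  by (simp add: signed_powr_def)

lemma signed_powr_compose: "signed_powr a (signed_powr c b) = signed_powr (c * a) b"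
  by (cases "b = 0") (auto simp: signed_powr_def abs_mult abs_sgn_eq sgn_mult powr_powr)

lemma signed_powr_1: "signed_powr 1 b = b"
  by (simp add: signed_powr_def sgn_mult_abs)

lemma signed_powr_pos: "0 \<le> b \<Longrightarrow> signed_powr a b = b powr a"
  by (cases "b = 0") (auto simp: signed_powr_def)

lemma abs_signed_powr: "\<bar>signed_powr a b\<bar> = \<bar>b\<bar> powr a"
  by (cases "b = 0") (auto simp: signed_powr_def abs_mult abs_sgn_eq)

lemma signed_powr_mult: "signed_powr a b * signed_powr c b = \<bar>b\<bar> powr (a + c)"
  by (cases "b = 0") (auto simp: signed_powr_def powr_add sgn_if)

lemma DERIV_signed_powr:
  assumes "b \<noteq> 0 \<or> 1 < a"
  shows "(signed_powr a has_real_derivative a * \<bar>b\<bar> powr (a - 1)) (at b)"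
proof -
  consider "b > 0" | "b < 0" | "b = 0" "1 < a" using assms by linarith
  then show ?thesis
  proof cases
    case 1
    have "((\<lambda>b. b powr a) has_real_derivative a * \<bar>b\<bar> powr (a - 1)) (at b)"
      using 1 by (auto intro!: derivative_eq_intros)
    then show ?thesis
      by (rule has_field_derivative_transform_within_open[where S = "{0<..}"])
        (use 1 in \<open>auto simp: signed_powr_def\<close>)
  next
    case 2
    have "((\<lambda>b. - ((- b) powr a)) has_real_derivative a * \<bar>b\<bar> powr (a - 1)) (at b)"
      using 2 by (auto intro!: derivative_eq_intros)
    then show ?thesis
      by (rule has_field_derivative_transform_within_open[where S = "{..<0}"])
        (use 2 in \<open>auto simp: signed_powr_def\<close>)
  next
    case 3
    have "((\<lambda>h::real. \<bar>h\<bar> powr (a - 1)) \<longlongrightarrow> \<bar>0\<bar> powr (a - 1)) (at 0)"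
      using 3 by (intro tendsto_powr' tendsto_intros) auto
    moreover have "\<forall>\<^sub>F h in at (0::real). \<bar>h\<bar> powr (a - 1) = (signed_powr a (0 + h) - signed_powr a 0) / h"
      unfolding eventually_at_filter
      by (intro always_eventually allI impI)
        (auto simp: signed_powr_def powr_diff sgn_if)
    ultimately have "((\<lambda>h. (signed_powr a (0 + h) - signed_powr a 0) / h) \<longlongrightarrow> 0) (at 0)"
      using Lim_transform_eventually by fastforce
    then show ?thesis using 3 by (simp add: DERIV_def)
  qed
qed

lemma continuous_signed_powr:
  assumes "0 < a"
  shows "continuous_on S (signed_powr a)"
proof -
  have "isCont (signed_powr a) b" for b
  proof (cases "b = 0")
    case False
    then show ?thesis using DERIV_signed_powr DERIV_isCont by blast
  next
    case True
    have "((\<lambda>h::real. \<bar>h\<bar> powr a) \<longlongrightarrow> \<bar>0\<bar> powr a) (at 0)"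
      using assms by (intro tendsto_powr' tendsto_intros) auto
    then have "((\<lambda>h. \<bar>signed_powr a h\<bar>) \<longlongrightarrow> 0) (at 0)"
      by (simp add: abs_signed_powr)
    then show ?thesis using True by (simp add: isCont_def tendsto_rabs_zero_cancel)
  qed
  then show ?thesis by (simp add: continuous_at_imp_continuous_on)
qed

lemma deriv_sigma_rp:
  assumes "1 < p" "p < 2"
  shows "(sigma_rp p has_real_derivative 2 / p * \<bar>b\<bar> powr (2 / p - 1)) (at b)"
    and "deriv (sigma_rp p) b = 2 / p * \<bar>b\<bar> powr (2 / p - 1)"
proof -
  have "1 < 2 / p" using assms by simp
  then show *: "(sigma_rp p has_real_derivative 2 / p * \<bar>b\<bar> powr (2 / p - 1)) (at b)"
    unfolding sigma_rp_eq_signed_powr by (intro DERIV_signed_powr) simp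
  show "deriv (sigma_rp p) b = 2 / p * \<bar>b\<bar> powr (2 / p - 1)"
    by (rule DERIV_imp_deriv[OF *])
qed

lemma deriv_sigma_rp_eq_0_iff:
  assumes "1 < p" "p < 2"
  shows "deriv (sigma_rp p) b = 0 \<longleftrightarrow> b = 0"
  using assms by (simp add: deriv_sigma_rp)

lemma continuous_deriv_sigma_rp:
  assumes "1 < p" "p < 2"
  shows "continuous_on S (deriv (sigma_rp p))"
proof -
  have "0 < 2 / p - 1" using assms by simp
  then have "continuous_on S (\<lambda>b. 2 / p * \<bar>b\<bar> powr (2 / p - 1))"
    by (intro continuous_intros continuous_on_powr') simp_all
  then show ?thesis using assms by (simp add: deriv_sigma_rp cong: continuous_on_cong)
qed

lemma continuous_sigma_rp_vec:
  assumes "0 < p"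
  shows "continuous_on S (sigma_rp_vec p)"
proof -
  have "continuous_on UNIV (sigma_rp p)"
    unfolding sigma_rp_eq_signed_powr using assms by (intro continuous_signed_powr) simp
  then have "continuous_on S (\<lambda>z. sigma_rp p (z $ i))" for i
    by (rule continuous_on_compose2) (simp_all add: continuous_on_component)
  then show ?thesis unfolding sigma_rp_vec_def by (rule continuous_on_vec_lambda)
qed

lemma sigma_rp_vec_inj:
  assumes "0 < p"
  shows "inj (sigma_rp_vec p)"
proof (rule inj_on_inverseI)
  show "(\<chi> i. signed_powr (p / 2) (sigma_rp_vec p w $ i)) = w" for w :: "real ^ 'n"
    using assms
    by (simp add: vec_eq_iff sigma_rp_vec_def sigma_rp_eq_signed_powr signed_powr_compose signed_powr_1)
qed

lemma inv_sigma_rp_vec: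
  assumes "0 < p"
  shows "inv (sigma_rp_vec p) u = (\<chi> i. signed_powr (p / 2) (u $ i))"
proof -
  have "sigma_rp_vec p (\<chi> i. signed_powr (p / 2) (u $ i)) = u" for u :: "real ^ 'n"
    using assms
    by (simp add: vec_eq_iff sigma_rp_vec_def sigma_rp_eq_signed_powr signed_powr_compose signed_powr_1)
  then show "inv (sigma_rp_vec p) u = (\<chi> i. signed_powr (p / 2) (u $ i))"
    using inv_f_eq[OF sigma_rp_vec_inj[OF assms]] by metis
qed

section \<open>The divergence in the original parameters\<close>

text \<open>The Bregman divergence of \<open>\<bar>x\<bar>\<^sup>p / p\<close> from the base point \<open>u = sigma_rp p b\<close> to \<open>x\<close>, written in terms of
\<open>b\<close>: here \<open>b\<^sup>2 = \<bar>u\<bar>\<^sup>p\<close>, and \<open>signed_powr (2 - 2 / p) b = sgn u * \<bar>u\<bar> powr (p - 1)\<close> is the mirror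
coordinate of \<open>u\<close>. In this form it is defined and continuous also at \<open>b = 0\<close>.\<close>

definition rp_divergence :: "real \<Rightarrow> real \<Rightarrow> real \<Rightarrow> real" where
  "rp_divergence p x b = \<bar>x\<bar> powr p / p + (1 - 1 / p) * b\<^sup>2 - signed_powr (2 - 2 / p) b * x"

text \<open>Homogeneity reduces the divergence to the base point 1, where it is the gap in the tangent
inequality. Nonnegativity and definiteness both follow from this formula.\<close>

lemma rp_divergence_eq_tangent_gap:
  fixes x :: real
  assumes p: "1 < p" and b: "b \<noteq> 0"
  defines "s \<equiv> x / sigma_rp p b"
  shows "rp_divergence p x b = b\<^sup>2 / p * (\<bar>s\<bar> powr p - (1 + p * (s - 1)))"
proof -
  have \<sigma>: "\<bar>sigma_rp p b\<bar> = \<bar>b\<bar> powr (2 / p)" "sigma_rp p b \<noteq> 0"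
    using b by (simp_all add: sigma_rp_eq_signed_powr abs_signed_powr)
      (simp add: signed_powr_def sgn_eq_0_iff)
  have x: "x = s * sigma_rp p b" using \<sigma> by (simp add: s_def)
  have b2: "\<bar>b\<bar> powr 2 = b\<^sup>2" using b by simp
  have "\<bar>x\<bar> powr p = \<bar>s\<bar> powr p * b\<^sup>2"
    unfolding x abs_mult \<sigma>(1) using p b2 by (simp add: powr_mult powr_powr)
  moreover have "signed_powr (2 - 2 / p) b * x = s * b\<^sup>2"
    using signed_powr_mult[of "2 - 2 / p" b "2 / p"] b2
    by (simp add: x sigma_rp_eq_signed_powr mult.left_commute)
  ultimately show ?thesis
    using p by (simp add: rp_divergence_def divide_simps) (simp add: algebra_simps)
qed

lemma rp_divergence_nonneg:
  assumes p: "1 < p"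
  shows "0 \<le> rp_divergence p x b"
proof (cases "b = 0")
  case True then show ?thesis using p by (simp add: rp_divergence_def)
next
  case False
  then show ?thesis
    using p abs_powr_tangent_at_one[OF p, of "x / sigma_rp p b"]
    by (simp add: rp_divergence_eq_tangent_gap[OF p False])
qed

lemma rp_divergence_eq_0_iff:
  assumes p: "1 < p"
  shows "rp_divergence p x b = 0 \<longleftrightarrow> x = sigma_rp p b"
proof (cases "b = 0")
  case True then show ?thesis using p by (simp add: rp_divergence_def sigma_rp_def)
next
  case False
  have \<sigma>: "sigma_rp p b \<noteq> 0" using False by (simp add: sigma_rp_def sgn_if)
  have "rp_divergence p x b = 0 \<longleftrightarrow> \<bar>x / sigma_rp p b\<bar> powr p = 1 + p * (x / sigma_rp p b - 1)"
    using p False by (simp add: rp_divergence_eq_tangent_gap[OF p False])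
  also have "\<dots> \<longleftrightarrow> x / sigma_rp p b = 1"
  proof
    assume "x / sigma_rp p b = 1"
    then show "\<bar>x / sigma_rp p b\<bar> powr p = 1 + p * (x / sigma_rp p b - 1)" by (simp only:) simp
  qed (rule abs_powr_tangent_at_one_strict[OF p])
  finally show ?thesis using \<sigma> by auto
qed

text \<open>The only term of indefinite sign is linear in \<open>x\<close>, so nonnegativity at \<open>2 * x\<close> bounds it at \<open>x\<close> by
half of the remaining terms at \<open>2 * x\<close>.\<close>

lemma rp_divergence_coercive:
  assumes p: "1 < p"
  shows "(1 - 1 / p) / 2 * b\<^sup>2 \<le> rp_divergence p x b + \<bar>2 * x\<bar> powr p / (2 * p)"
proof -
  have "0 \<le> rp_divergence p (2 * x) b" by (rule rp_divergence_nonneg[OF p])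
  then have "0 \<le> \<bar>2 * x\<bar> powr p / p + (1 - 1 / p) * b\<^sup>2 - 2 * (signed_powr (2 - 2 / p) b * x)"
    by (simp only: rp_divergence_def mult.left_commute[of _ 2 x])
  moreover have "0 \<le> \<bar>x\<bar> powr p / p" using p by simp
  moreover have "(1 - 1 / p) / 2 * b\<^sup>2 = ((1 - 1 / p) * b\<^sup>2) / 2"
    "\<bar>2 * x\<bar> powr p / (2 * p) = (\<bar>2 * x\<bar> powr p / p) / 2" by simp_all
  moreover have "0 \<le> u + m - 2 * v \<Longrightarrow> 0 \<le> r \<Longrightarrow> m / 2 \<le> r + m - v + u / 2" for u m v r :: real
    by simp
  ultimately show ?thesis unfolding rp_divergence_def by presburger
qed

text \<open>The derivative of the mirror coordinate, \<open>(2 - 2/p) \<bar>b\<bar> powr (1 - 2/p)\<close>, and that of \<open>sigma_rp p\<close>,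
\<open>(2/p) \<bar>b\<bar> powr (2/p - 1)\<close>, multiply to a constant. This cancellation turns the degenerate gradient
flow in \<open>w\<close> into a mirror flow. At \<open>w t = 0\<close> the first factor is infinite.\<close>

lemma DERIV_rp_divergence_along_flow:
  assumes p: "1 < p" "p < 2" and nz: "w t \<noteq> 0"
    and w: "(w has_real_derivative - (deriv (sigma_rp p) (w t) * q)) (at t)"
  shows "((\<lambda>t. rp_divergence p x (w t)) has_real_derivative
           4 * (p - 1) / p\<^sup>2 * (q * (x - sigma_rp p (w t)))) (at t)"
proof -
  define D where "D = 2 / p * \<bar>w t\<bar> powr (2 / p - 1)"
  have w': "(w has_real_derivative - (D * q)) (at t)"
    using w unfolding deriv_sigma_rp(2)[OF p] D_def .
  have wD: "w t * D = 2 / p * sigma_rp p (w t)"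
  proof -
    have "w t * \<bar>w t\<bar> powr (2 / p - 1) = sgn (w t) * (\<bar>w t\<bar> powr 1 * \<bar>w t\<bar> powr (2 / p - 1))"
      by (simp add: sgn_if)
    also have "\<dots> = sigma_rp p (w t)"
      by (simp only: sigma_rp_def powr_add[symmetric]) simp
    finally show ?thesis by (simp add: D_def)
  qed
  have MD: "(2 - 2 / p) * \<bar>w t\<bar> powr (2 - 2 / p - 1) * D = 4 * (p - 1) / p\<^sup>2"
  proof -
    have "(2 - 2 / p) * \<bar>w t\<bar> powr (2 - 2 / p - 1) * D
        = (2 - 2 / p) * (2 / p) * (\<bar>w t\<bar> powr (2 - 2 / p - 1) * \<bar>w t\<bar> powr (2 / p - 1))"
      by (simp add: D_def)
    also have "\<bar>w t\<bar> powr (2 - 2 / p - 1) * \<bar>w t\<bar> powr (2 / p - 1) = 1"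
      using nz by (simp add: powr_add[symmetric])
    finally show ?thesis using p by (simp add: power2_eq_square field_simps)
  qed
  have square: "((\<lambda>t. (w t)\<^sup>2) has_real_derivative 2 * w t * - (D * q)) (at t)"
    using DERIV_power[OF w', of 2] by (simp add: mult_ac)
  have mirror: "((\<lambda>t. signed_powr (2 - 2 / p) (w t)) has_real_derivative
      (2 - 2 / p) * \<bar>w t\<bar> powr (2 - 2 / p - 1) * - (D * q)) (at t)"
    using nz by (intro DERIV_chain2[OF DERIV_signed_powr w']) simp
  have "((\<lambda>t. rp_divergence p x (w t)) has_real_derivative
      (1 - 1 / p) * (2 * w t * - (D * q))
      - ((2 - 2 / p) * \<bar>w t\<bar> powr (2 - 2 / p - 1) * - (D * q)) * x) (at t)"
    unfolding rp_divergence_def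
    using DERIV_diff[OF DERIV_add[OF DERIV_const DERIV_cmult[OF square]] DERIV_cmult_right[OF mirror]]
    by (simp only: add_0)
  moreover have "(1 - 1 / p) * (2 * w t * - (D * q))
      - ((2 - 2 / p) * \<bar>w t\<bar> powr (2 - 2 / p - 1) * - (D * q)) * x
      = - (2 * (1 - 1 / p) * q) * (w t * D)
        + ((2 - 2 / p) * \<bar>w t\<bar> powr (2 - 2 / p - 1) * D) * q * x"
    by (simp add: algebra_simps)
  moreover have "\<dots> = 4 * (p - 1) / p\<^sup>2 * (q * (x - sigma_rp p (w t)))"
    unfolding wD MD using p by (simp add: power2_eq_square field_simps)
  ultimately show ?thesis by metis
qed

lemma continuous_rp_divergence:
  assumes "1 < p"
  shows "continuous_on S (rp_divergence p x)"
proof -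
  have "2 / p < 2" using assms by (simp add: field_simps)
  then show ?thesis unfolding rp_divergence_def using assms
    by (intro continuous_intros continuous_signed_powr) auto
qed

definition total_divergence :: "real \<Rightarrow> real ^ 'n \<Rightarrow> real ^ 'n \<Rightarrow> real" where
  "total_divergence p z w = (\<Sum>i\<in>UNIV. rp_divergence p (z $ i) (w $ i))"

lemma total_divergence_nonneg: "1 < p \<Longrightarrow> 0 \<le> total_divergence p z w"
  by (simp add: total_divergence_def sum_nonneg rp_divergence_nonneg)

lemma total_divergence_eq_0_iff:
  "1 < p \<Longrightarrow> total_divergence p z w = 0 \<longleftrightarrow> z = sigma_rp_vec p w"
  by (simp add: total_divergence_def sum_nonneg_eq_0_iff rp_divergence_nonneg
      rp_divergence_eq_0_iff vec_eq_iff sigma_rp_vec_def)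

lemma continuous_total_divergence:
  assumes "1 < p"
  shows "continuous_on S (total_divergence p z)"
proof -
  have "continuous_on S (\<lambda>w. rp_divergence p (z $ i) (w $ i))" for i
    by (rule continuous_on_compose2[OF continuous_rp_divergence[OF assms, of UNIV]])
      (simp_all add: continuous_on_component)
  then show ?thesis unfolding total_divergence_def by (intro continuous_on_sum)
qed

text \<open>The coercivity bound, summed over the entries. The base point \<open>w\<close> is the argument that moves along
the flow, so this confines trajectories along which the divergence decreases.\<close>

lemma total_divergence_sublevel_bounded:
  fixes z :: "real ^ 'n"
  assumes p: "1 < p"
  shows "bounded {w. total_divergence p z w \<le> K}"
proof -
  define C where "C = (\<Sum>i\<in>(UNIV::'n set). \<bar>2 * z $ i\<bar> powr p / (2 * p))"
  define a where "a = (1 - 1 / p) / 2"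
  have a: "0 < a" using p by (simp add: a_def)
  have "norm w \<le> 1 + (K + C) / a" if "total_divergence p z w \<le> K" for w
  proof -
    have "a * (norm w)\<^sup>2 = (\<Sum>i\<in>UNIV. a * (w $ i)\<^sup>2)"
      unfolding power2_norm_eq_inner inner_vec_def sum_distrib_left inner_real_def
      by (simp only: power2_eq_square)
    also have "\<dots> \<le> (\<Sum>i\<in>UNIV. rp_divergence p (z $ i) (w $ i) + \<bar>2 * z $ i\<bar> powr p / (2 * p))"
      unfolding a_def by (intro sum_mono rp_divergence_coercive[OF p])
    also have "\<dots> \<le> K + C"
      using that by (simp add: total_divergence_def C_def sum.distrib)
    finally have sq: "(norm w)\<^sup>2 \<le> (K + C) / a" using a by (simp add: field_simps)
    \<comment> \<open>Avoids a square root: \<open>2 * norm w \<le> 1 + (norm w)\<^sup>2\<close>.\<close>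
    have "0 \<le> (norm w - 1)\<^sup>2" by simp
    then have "2 * norm w \<le> 1 + (norm w)\<^sup>2" by (simp add: power2_eq_square algebra_simps)
    moreover have "0 \<le> (norm w)\<^sup>2" by simp
    ultimately show ?thesis using sq by linarith
  qed
  then show ?thesis by (auto simp: bounded_iff)
qed

section \<open>Gradients\<close>

lemma gradient_eqI:
  assumes "GDERIV f x :> g"
  shows "gradient f x = g"
  unfolding gradient_def
proof (rule the_equality[where P = "\<lambda>g. GDERIV f x :> g", OF assms])
  fix g' assume "GDERIV f x :> g'"
  then have "(\<lambda>h. h \<bullet> g') = (\<lambda>h. h \<bullet> g)"
    using assms has_derivative_unique unfolding gderiv_def by blast
  then have "(g' - g) \<bullet> (g' - g) = 0"
    by (metis inner_diff_right right_minus_eq)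
  then show "g' = g" by simp
qed

text \<open>Restriction to the line through \<open>x\<close> and \<open>x'\<close> reduces the claim to one variable.\<close>

lemma convex_above_gradient_tangent:
  assumes convex: "convex_on UNIV f" and g: "GDERIV f x :> g"
  shows "g \<bullet> (x' - x) \<le> f x' - f x"
proof -
  define \<phi> where "\<phi> t = f (x + t *\<^sub>R (x' - x))" for t :: real
  have "convex_on UNIV \<phi>"
  proof (rule convex_onI)
    fix t a b :: real assume t: "0 < t" "t < 1"
    have "x + ((1 - t) *\<^sub>R a + t *\<^sub>R b) *\<^sub>R (x' - x)
        = (1 - t) *\<^sub>R (x + a *\<^sub>R (x' - x)) + t *\<^sub>R (x + b *\<^sub>R (x' - x))"
      by (simp add: algebra_simps)
    then show "\<phi> ((1 - t) *\<^sub>R a + t *\<^sub>R b) \<le> (1 - t) * \<phi> a + t * \<phi> b"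
      unfolding \<phi>_def using convex_onD[OF convex, of t] t by simp
  qed simp
  moreover have "(\<phi> has_real_derivative (x' - x) \<bullet> g) (at 0)"
  proof -
    have line: "((\<lambda>t::real. x + t *\<^sub>R (x' - x)) has_derivative (\<lambda>t. t *\<^sub>R (x' - x))) (at 0)"
      by (auto intro!: derivative_eq_intros)
    have "(f has_derivative (\<lambda>h. h \<bullet> g)) (at (x + 0 *\<^sub>R (x' - x)))"
      using g by (simp add: gderiv_def)
    from has_derivative_compose[OF line this] show ?thesis
      unfolding \<phi>_def has_field_derivative_def
      by (simp add: mult.commute[of "(x' - x) \<bullet> g"] mult_commute_abs)
  qed
  ultimately have "((x' - x) \<bullet> g) * (1 - 0) \<le> \<phi> 1 - \<phi> 0"
    by (intro convex_on_imp_above_tangent[of UNIV]) auto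
  then show ?thesis by (simp add: \<phi>_def inner_commute)
qed

lemma continuously_differentiable_partial_gradient:
  fixes L :: "(real ^ 'm) \<times> (real ^ 'm) \<Rightarrow> real"
  assumes "continuously_differentiable L"
  obtains g where "\<And>x. GDERIV (\<lambda>x. L (x, y)) x :> g x" "continuous_on UNIV g"
proof -
  obtain L' where L': "\<And>x. (L has_derivative blinfun_apply (L' x)) (at x)"
    and cont: "continuous_on UNIV L'"
    using assms unfolding continuously_differentiable_def by blast
  define g where "g x = (\<chi> i. blinfun_apply (L' (x, y)) (axis i 1, 0))" for x :: "real ^ 'm"
  show ?thesis
  proof
    fix x :: "real ^ 'm"
    have pair: "((\<lambda>x. (x, y)) has_derivative (\<lambda>h. (h, 0))) (at x)"
      by (auto intro!: derivative_eq_intros)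
    have "blinfun_apply (L' (x, y)) (h, 0) = h \<bullet> g x" for h
    proof -
      have "(h, 0) = (\<Sum>i\<in>UNIV. (h $ i) *\<^sub>R (axis i 1 :: real ^ 'm, 0 :: real ^ 'm))"
        by (simp add: prod_eq_iff fst_sum snd_sum) (simp add: vec_eq_iff axis_def if_distrib cong: if_cong)
      then have "blinfun_apply (L' (x, y)) (h, 0)
          = (\<Sum>i\<in>UNIV. (h $ i) *\<^sub>R blinfun_apply (L' (x, y)) (axis i 1, 0))"
        by (simp only: blinfun.sum_right blinfun.scaleR_right)
      then show ?thesis by (simp add: inner_vec_def g_def)
    qed
    then show "GDERIV (\<lambda>x. L (x, y)) x :> g x"
      using has_derivative_compose[OF pair L'[of "(x, y)"]] by (simp add: gderiv_def)
  next
    have "continuous_on UNIV (\<lambda>x. L' (x, y))"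
      by (rule continuous_on_compose2[OF cont]) (auto intro!: continuous_intros)
    then show "continuous_on UNIV g"
      unfolding g_def by (intro continuous_on_vec_lambda blinfun.continuous_on continuous_on_const)
  qed
qed

section \<open>The gradient flow of the reparametrized loss\<close>

lemma has_derivative_sigma_rp_vec:
  fixes w :: "real ^ 'n"
  assumes "1 < p" "p < 2"
  shows "(sigma_rp_vec p has_derivative (\<lambda>h. \<chi> i. deriv (sigma_rp p) (w $ i) * h $ i)) (at w)"
proof -
  have component: "((\<lambda>w. sigma_rp p (w $ i)) has_derivative (\<lambda>h. deriv (sigma_rp p) (w $ i) * h $ i)) (at w)" for i
  proof -
    have "(sigma_rp p has_derivative (*) (deriv (sigma_rp p) (w $ i))) (at (w $ i))"
      using deriv_sigma_rp[OF assms] by (simp add: has_field_derivative_def)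
    from has_derivative_compose[OF bounded_linear_imp_has_derivative[OF bounded_linear_vec_nth] this]
    show ?thesis .
  qed
  show ?thesis
  proof (rule has_derivative_componentwise_within[THEN iffD2], rule ballI)
    fix b :: "real ^ 'n" assume "b \<in> Basis"
    then obtain i where b: "b = axis i 1" by (auto simp: Basis_vec_def)
    show "((\<lambda>w. sigma_rp_vec p w \<bullet> b) has_derivative
        (\<lambda>h. (\<chi> i. deriv (sigma_rp p) (w $ i) * h $ i) \<bullet> b)) (at w)"
      using component[of i] by (simp add: b inner_axis sigma_rp_vec_def)
  qed
qed

text \<open>The second argument of the loss stays equal to \<open>y\<close> throughout, so only the partial function \<open>l\<close> of the
prediction and its gradient \<open>g\<close> matter.\<close>

locale reparametrized_loss =
  fixes p :: real and A :: "real ^ 'n ^ 'm" and y :: "real ^ 'm"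
    and l :: "real ^ 'm \<Rightarrow> real" and g :: "real ^ 'm \<Rightarrow> real ^ 'm"
  assumes p: "1 < p" "p < 2"
    and y_range: "y \<in> range (\<lambda>x. A *v x)"
    and convex_l: "convex_on UNIV l"
    and gderiv_l: "\<And>x. GDERIV l x :> g x"
    and cont_g: "continuous_on UNIV g"
    and l_nonneg: "\<And>x. 0 \<le> l x"
    and l_zero_iff: "\<And>x. l x = 0 \<longleftrightarrow> x = y"
begin

definition loss :: "real ^ 'n \<Rightarrow> real" where
  "loss w = l (A *v sigma_rp_vec p w)"

text \<open>The gradient of the loss with respect to \<open>u = sigma_rp_vec p w\<close>, on which the loss depends through
the linear map \<open>A\<close>.\<close>

definition linear_gradient :: "real ^ 'n \<Rightarrow> real ^ 'n" where
  "linear_gradient w = transpose A *v g (A *v sigma_rp_vec p w)"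

lemma gradient_loss:
  "gradient loss w = (\<chi> i. deriv (sigma_rp p) (w $ i) * linear_gradient w $ i)"
proof (rule gradient_eqI)
  have "((\<lambda>w. A *v sigma_rp_vec p w) has_derivative
      (\<lambda>h. A *v (\<chi> i. deriv (sigma_rp p) (w $ i) * h $ i))) (at w)"
    by (rule bounded_linear.has_derivative[OF matrix_vector_mul_bounded_linear has_derivative_sigma_rp_vec[OF p]])
  from has_derivative_compose[OF this gderiv_l[unfolded gderiv_def]]
  have "(loss has_derivative
      (\<lambda>h. (A *v (\<chi> i. deriv (sigma_rp p) (w $ i) * h $ i)) \<bullet> g (A *v sigma_rp_vec p w))) (at w)"
    by (simp add: loss_def[abs_def])
  moreover have "(A *v (\<chi> i. deriv (sigma_rp p) (w $ i) * h $ i)) \<bullet> g (A *v sigma_rp_vec p w)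
      = h \<bullet> (\<chi> i. deriv (sigma_rp p) (w $ i) * linear_gradient w $ i)" for h
  proof -
    have "(A *v x) \<bullet> b = x \<bullet> (transpose A *v b)" for x b
      by (metis dot_lmul_matrix inner_commute transpose_matrix_vector)
    then show ?thesis
      by (simp add: linear_gradient_def) (simp add: inner_vec_def mult_ac)
  qed
  ultimately show "GDERIV loss w :> (\<chi> i. deriv (sigma_rp p) (w $ i) * linear_gradient w $ i)"
    by (simp add: gderiv_def)
qed

lemma continuous_prediction: "continuous_on S (\<lambda>w. A *v sigma_rp_vec p w)"
proof -
  have "continuous_on S (sigma_rp_vec p)" using p by (intro continuous_sigma_rp_vec) simp
  then show ?thesis
    by (rule continuous_on_compose2[OF matrix_vector_mult_linear_continuous_on[of UNIV A]]) simp
qed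

lemma continuous_gradient_loss: "continuous_on UNIV (gradient loss)"
proof -
  have "continuous_on UNIV (\<lambda>w. g (A *v sigma_rp_vec p w))"
    by (rule continuous_on_compose2[OF cont_g continuous_prediction]) simp
  then have "continuous_on UNIV linear_gradient"
    unfolding linear_gradient_def
    by (rule continuous_on_compose2[OF matrix_vector_mult_linear_continuous_on[of UNIV "transpose A"]]) simp
  moreover have "continuous_on UNIV (\<lambda>w::real ^ 'n. deriv (sigma_rp p) (w $ i))" for i
    by (rule continuous_on_compose2[OF continuous_deriv_sigma_rp[OF p, of UNIV]])
      (simp_all add: continuous_on_component)
  ultimately have "continuous_on UNIV (\<lambda>w. \<chi> i. deriv (sigma_rp p) (w $ i) * linear_gradient w $ i)"
    by (intro continuous_on_vec_lambda continuous_on_mult continuous_on_component)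
  then show ?thesis by (simp add: gradient_loss[abs_def])
qed

lemma continuous_loss: "continuous_on UNIV loss"
proof -
  have "continuous_on UNIV l"
    using gderiv_l has_derivative_continuous unfolding gderiv_def continuous_on_eq_continuous_within by blast
  then show ?thesis
    unfolding loss_def by (rule continuous_on_compose2[OF _ continuous_prediction]) simp
qed

lemma loss_zero_iff: "loss w = 0 \<longleftrightarrow> A *v sigma_rp_vec p w = y"
  by (simp add: loss_def l_zero_iff)

text \<open>The constant product of derivatives from \<open>DERIV_rp_divergence_along_flow\<close>.\<close>

definition rate :: real where "rate = 4 * (p - 1) / p\<^sup>2"

lemma rate_pos: "0 < rate"
  using p by (simp add: rate_def)

text \<open>Integrated form of the mirror flow identity. Regularity enters here: the pointwise derivative is
available only while no entry of \<open>v\<close> vanishes, and finitely many exceptional times do not affect the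
fundamental theorem of calculus. The integrand depends on \<open>z\<close> only through \<open>A *v z\<close>.\<close>

lemma divergence_along_flow:
  assumes reg: "regular_solution p loss w0 T v"
    and ab: "0 \<le> a" "a \<le> b" "b \<in> time_interval T"
  shows "((\<lambda>s. rate * (g (A *v sigma_rp_vec p (v s)) \<bullet> (A *v z - A *v sigma_rp_vec p (v s))))
    has_integral (total_divergence p z (v b) - total_divergence p z (v a))) {a..b}"
proof -
  define S where "S = {t \<in> time_interval T. \<exists>i. v t $ i = 0}"
  have sub: "{a..b} \<subseteq> time_interval T"
    using ab by (auto simp: time_interval_def) (meson ereal_less_eq(3) le_less_trans)
  have S: "finite S"
    using reg p by (simp add: regular_solution_def S_def deriv_sigma_rp_eq_0_iff)
  have sol: "(v has_vector_derivative - gradient loss (v t)) (at t within time_interval T)"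
    if "t \<in> time_interval T" for t
    using reg that by (auto simp: regular_solution_def gradient_flow_solution_def)
  have "continuous_on (time_interval T) v"
    using sol has_vector_derivative_continuous unfolding continuous_on_eq_continuous_within by blast
  then have contv: "continuous_on {a..b} v" using sub continuous_on_subset by blast
  show ?thesis
  proof (rule fundamental_theorem_of_calculus_interior_strong[OF S ab(2)])
    show "continuous_on {a..b} (\<lambda>s. total_divergence p z (v s))"
      by (rule continuous_on_compose2[OF continuous_total_divergence[OF p(1), of UNIV] contv]) simp
    fix t assume t: "t \<in> {a<..<b} - S"
    then have "t \<in> time_interval T" using sub by auto
    then have nz: "v t $ i \<noteq> 0" for i using t by (auto simp: S_def)
    have vt: "(v has_vector_derivative - gradient loss (v t)) (at t)"
      by (rule has_vector_derivative_at_interior[OF sol, of _ "{a<..<b}"])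
        (use t sub in auto)
    define q where "q = linear_gradient (v t)"
    have "((\<lambda>s. rp_divergence p (z $ i) (v s $ i)) has_real_derivative
        rate * (q $ i * (z $ i - sigma_rp p (v t $ i)))) (at t)" for i
    proof -
      have "((\<lambda>s. v s $ i) has_vector_derivative (- gradient loss (v t)) $ i) (at t)"
        by (rule bounded_linear.has_vector_derivative[OF bounded_linear_vec_nth vt])
      then have "((\<lambda>s. v s $ i) has_real_derivative - (deriv (sigma_rp p) (v t $ i) * q $ i)) (at t)"
        by (simp add: has_real_derivative_iff_has_vector_derivative gradient_loss q_def)
      then show ?thesis
        unfolding rate_def by (intro DERIV_rp_divergence_along_flow p nz)
    qed
    then have "((\<lambda>s. total_divergence p z (v s)) has_real_derivative
        (\<Sum>i\<in>UNIV. rate * (q $ i * (z $ i - sigma_rp p (v t $ i))))) (at t)"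
      unfolding total_divergence_def by (intro DERIV_sum)
    moreover have "(\<Sum>i\<in>UNIV. rate * (q $ i * (z $ i - sigma_rp p (v t $ i))))
        = rate * (q \<bullet> (z - sigma_rp_vec p (v t)))"
      by (simp add: inner_vec_def sigma_rp_vec_def sum_distrib_left)
    moreover have "q \<bullet> (z - sigma_rp_vec p (v t))
        = g (A *v sigma_rp_vec p (v t)) \<bullet> (A *v z - A *v sigma_rp_vec p (v t))"
      by (simp add: q_def linear_gradient_def transpose_matrix_vector dot_lmul_matrix
          matrix_vector_mult_diff_distrib)
    ultimately show "((\<lambda>s. total_divergence p z (v s)) has_vector_derivative
        rate * (g (A *v sigma_rp_vec p (v t)) \<bullet> (A *v z - A *v sigma_rp_vec p (v t)))) (at t)"
      by (simp add: has_real_derivative_iff_has_vector_derivative)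
  qed
qed

text \<open>For an interpolating \<open>z\<close>, convexity bounds the integrand of the flow identity by \<open>- rate * loss (v s)\<close>.\<close>

lemma divergence_decay:
  assumes reg: "regular_solution p loss w0 T v"
    and ab: "0 \<le> a" "a \<le> b" "b \<in> time_interval T"
    and z: "A *v z = y" and big: "\<And>s. s \<in> {a..b} \<Longrightarrow> e \<le> loss (v s)"
  shows "total_divergence p z (v b) \<le> total_divergence p z (v a) - rate * e * (b - a)"
proof -
  have "((\<lambda>s. - rate * e) has_integral (b - a) *\<^sub>R (- rate * e)) {a..b}"
    using has_integral_const_real[of "- rate * e" a b] ab by simp
  then have "total_divergence p z (v b) - total_divergence p z (v a) \<le> (b - a) *\<^sub>R (- rate * e)"
  proof (rule has_integral_le[OF divergence_along_flow[OF reg ab, of z]])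
    fix s assume s: "s \<in> {a..b}"
    have "g (A *v sigma_rp_vec p (v s)) \<bullet> (A *v z - A *v sigma_rp_vec p (v s)) \<le> l y - loss (v s)"
      using convex_above_gradient_tangent[OF convex_l gderiv_l] by (simp add: loss_def z)
    also have "\<dots> \<le> - e" using big[OF s] l_zero_iff[of y] by simp
    finally show "rate * (g (A *v sigma_rp_vec p (v s)) \<bullet> (A *v z - A *v sigma_rp_vec p (v s))) \<le> - rate * e"
      using mult_left_mono[of _ "- e" rate] rate_pos by simp
  qed
  then show ?thesis by (simp add: algebra_simps)
qed

lemma divergence_decreasing:
  assumes "regular_solution p loss w0 T v" "0 \<le> a" "a \<le> b" "b \<in> time_interval T" "A *v z = y"
  shows "total_divergence p z (v b) \<le> total_divergence p z (v a)"
  using divergence_decay[OF assms, of 0] by (simp add: loss_def l_nonneg)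

text \<open>The two divergences have the same derivative. This conservation law identifies which interpolating
vector the flow selects.\<close>

lemma divergence_difference_conserved:
  assumes reg: "regular_solution p loss w0 T v" and b: "b \<in> time_interval T"
    and z: "A *v z = A *v z'"
  shows "total_divergence p z (v b) - total_divergence p z' (v b)
       = total_divergence p z w0 - total_divergence p z' w0"
proof -
  have b0: "0 \<le> b" using b by (simp add: time_interval_def)
  have "total_divergence p z (v b) - total_divergence p z (v 0)
      = total_divergence p z' (v b) - total_divergence p z' (v 0)"
    using divergence_along_flow[OF reg order_refl b0 b, of z]
      divergence_along_flow[OF reg order_refl b0 b, of z']
    unfolding z by (rule has_integral_unique)
  moreover have "v 0 = w0" using reg by (simp add: regular_solution_def gradient_flow_solution_def)
  ultimately show ?thesis by simp
qed

lemma regular_solution_bounded: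
  assumes reg: "regular_solution p loss w0 T v"
  shows "bounded (v ` time_interval T)"
proof -
  obtain z where z: "A *v z = y" using y_range by auto
  have "v ` time_interval T \<subseteq> {w. total_divergence p z w \<le> total_divergence p z (v 0)}"
    using divergence_decreasing[OF reg order_refl _ _ z] by (auto simp: time_interval_def)
  then show ?thesis using total_divergence_sublevel_bounded[OF p(1)] bounded_subset by blast
qed

lemma regular_solution_not_maximal:
  assumes T: "0 < T" and reg: "regular_solution p loss w0 (ereal T) w"
  shows "\<not> maximal_solution loss w0 T w"
proof
  assume max: "maximal_solution loss w0 T w"
  have int: "time_interval (ereal r) = {0..<r}" for r by (auto simp: time_interval_def)
  have sol: "gradient_flow_solution loss w0 (ereal T) w" using reg by (simp add: regular_solution_def)
  obtain \<delta> x where \<delta>: "0 < \<delta>" and eq: "\<And>t. t \<in> {0..<T} \<Longrightarrow> x t = w t"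
    and x: "\<And>t. t \<in> {0..T + \<delta>} \<Longrightarrow> (x has_vector_derivative - gradient loss (x t)) (at t within {0..T + \<delta>})"
  proof (rule bounded_solution_extends[of "\<lambda>w. - gradient loss w" T w])
    show "continuous_on UNIV (\<lambda>w. - gradient loss w)"
      by (intro continuous_on_minus continuous_gradient_loss)
    show "bounded (w ` {0..<T})" using regular_solution_bounded[OF reg] by (simp add: int)
  qed (use sol T in \<open>auto simp: gradient_flow_solution_def int\<close>)
  have "gradient_flow_solution loss w0 (ereal (T + \<delta>)) x"
    unfolding gradient_flow_solution_def int
  proof (intro conjI ballI)
    show "x 0 = w0" using eq[of 0] T sol by (simp add: gradient_flow_solution_def)
    show "(x has_vector_derivative - gradient loss (x t)) (at t within {0..<T + \<delta>})"
      if "t \<in> {0..<T + \<delta>}" for t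
      by (rule has_vector_derivative_within_subset[OF x]) (use that in auto)
  qed
  then show False using max \<delta> eq unfolding maximal_solution_def int by metis
qed

text \<open>The divergence from any interpolating vector is nonnegative and decays at least at \<open>rate\<close> times
the loss, so the loss is small at arbitrarily late times \<open>\<tau> n\<close>. A cluster point \<open>w\<close> along these times
interpolates. The divergence \<open>E\<close> that belongs to \<open>w\<close> itself is decreasing and tends to zero along a
subsequence, hence tends to zero; by definiteness and compact sublevel sets the whole trajectory
converges to \<open>w\<close>. Letting \<open>t \<rightarrow> \<infinity>\<close> in the conservation law shows that \<open>w\<close> minimizes the divergence
from the initial point among all interpolating vectors.\<close>

lemma regular_solution_converges:
  assumes reg: "regular_solution p loss w0 \<infinity> v"
  obtains w where "(v \<longlongrightarrow> w) at_top" "A *v sigma_rp_vec p w = y"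
    "\<And>z. A *v z = y \<Longrightarrow> total_divergence p (sigma_rp_vec p w) w0 \<le> total_divergence p z w0"
proof -
  have int: "t \<in> time_interval \<infinity> \<longleftrightarrow> 0 \<le> t" for t by (simp add: time_interval_def)
  obtain z0 where z0: "A *v z0 = y" using y_range by auto
  have "\<exists>t\<ge>real n. loss (v t) < inverse (real (Suc n))" for n
  proof (rule ccontr)
    let ?e = "inverse (real (Suc n))"
    assume "\<not> ?thesis"
    then have big: "?e \<le> loss (v t)" if "real n \<le> t" for t using that by force
    define K where "K = total_divergence p z0 (v (real n))"
    have e: "0 < rate * ?e" using rate_pos by simp
    have K: "0 \<le> K" by (simp add: K_def total_divergence_nonneg p)
    \<comment> \<open>If the loss stayed above \<open>?e\<close>, the divergence would be used up after time \<open>h\<close>.\<close>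
    define h where "h = (K + 1) / (rate * ?e)"
    have h: "0 \<le> h" "rate * ?e * h = K + 1"
      using e K by (auto simp: h_def)
    have "total_divergence p z0 (v (real n + h)) \<le> K - rate * ?e * (real n + h - real n)"
      unfolding K_def by (rule divergence_decay[OF reg]) (use h z0 big in \<open>auto simp: int\<close>)
    also have "\<dots> < 0" using h by simp
    finally show False using total_divergence_nonneg[OF p(1), of z0 "v (real n + h)"] by simp
  qed
  then obtain \<tau> where \<tau>: "\<And>n. real n \<le> \<tau> n" "\<And>n. loss (v (\<tau> n)) < inverse (real (Suc n))"
    by metis
  have \<tau>0: "0 \<le> \<tau> n" for n using \<tau>(1)[of n] of_nat_0_le_iff order_trans by blast
  have "bounded (range (\<lambda>n. v (\<tau> n)))"
    using regular_solution_bounded[OF reg] by (rule bounded_subset) (auto simp: int \<tau>0)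
  then obtain w r where r: "strict_mono (r :: nat \<Rightarrow> nat)" and lim: "(\<lambda>n. v (\<tau> (r n))) \<longlonglongrightarrow> w"
    using bounded_imp_convergent_subsequence[of "\<lambda>n. v (\<tau> n)"] by (auto simp: o_def)
  have "(\<lambda>n. loss (v (\<tau> (r n)))) \<longlonglongrightarrow> loss w"
    using continuous_loss lim by (auto simp: continuous_on_eq_continuous_at intro: isCont_tendsto_compose)
  moreover have vanish: "(\<lambda>n. loss (v (\<tau> n))) \<longlonglongrightarrow> 0"
  proof (rule real_tendsto_sandwich[OF _ _ tendsto_const LIMSEQ_inverse_real_of_nat])
    show "\<forall>\<^sub>F n in sequentially. 0 \<le> loss (v (\<tau> n))" by (simp add: loss_def l_nonneg)
    show "\<forall>\<^sub>F n in sequentially. loss (v (\<tau> n)) \<le> inverse (real (Suc n))"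
      using \<tau>(2) by (intro always_eventually allI less_imp_le)
  qed
  moreover have "(\<lambda>n. loss (v (\<tau> (r n)))) \<longlonglongrightarrow> 0"
    using LIMSEQ_subseq_LIMSEQ[OF vanish r] by (simp only: o_def)
  ultimately have "loss w = 0" using LIMSEQ_unique by blast
  then have w: "A *v sigma_rp_vec p w = y" by (simp add: loss_zero_iff)
  define E where "E t = total_divergence p (sigma_rp_vec p w) (v t)" for t
  have contD: "isCont (total_divergence p (sigma_rp_vec p w)) x" for x
    using continuous_total_divergence[OF p(1), of UNIV "sigma_rp_vec p w"]
    by (simp add: continuous_on_eq_continuous_at)
  have "(\<lambda>n. E (\<tau> (r n))) \<longlonglongrightarrow> total_divergence p (sigma_rp_vec p w) w"
    unfolding E_def by (rule isCont_tendsto_compose[OF contD lim])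
  moreover have "total_divergence p (sigma_rp_vec p w) w = 0"
    using total_divergence_eq_0_iff[OF p(1)] by blast
  ultimately have Elim: "(\<lambda>n. E (\<tau> (r n))) \<longlonglongrightarrow> 0" by simp
  have E_small: "\<exists>t0\<ge>0. \<forall>t\<ge>t0. E t < e" if e: "0 < e" for e
  proof -
    obtain n where n: "E (\<tau> (r n)) < e"
      using order_tendstoD(2)[OF Elim e] by (auto simp: eventually_sequentially)
    have "E t \<le> E (\<tau> (r n))" if "\<tau> (r n) \<le> t" for t
      unfolding E_def using that \<tau>0[of "r n"]
      by (intro divergence_decreasing[OF reg _ that _ w]) (auto simp: int)
    then show ?thesis using n \<tau>0[of "r n"] by (meson le_less_trans)
  qed
  have "(v \<longlongrightarrow> w) at_top"
  proof (rule tendstoI)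
    fix e :: real assume e: "0 < e"
    \<comment> \<open>On the compact set \<open>K\<close> of points away from \<open>w\<close> the divergence has a positive minimum \<open>m\<close>, so
      the trajectory leaves \<open>K\<close> once \<open>E\<close> is below \<open>m\<close>.\<close>
    define K where "K = {x. total_divergence p (sigma_rp_vec p w) x \<le> 1} - ball w e"
    have "closed {x. total_divergence p (sigma_rp_vec p w) x \<le> 1}"
      by (intro closed_Collect_le continuous_total_divergence[OF p(1)] continuous_on_const)
    then have "compact K"
      using total_divergence_sublevel_bounded[OF p(1)] unfolding K_def
      by (intro compact_diff open_ball) (auto simp: compact_eq_bounded_closed)
    have "\<exists>m>0. \<forall>x\<in>K. m \<le> total_divergence p (sigma_rp_vec p w) x"
    proof (cases "K = {}")
      case False
      then obtain x0 where x0: "x0 \<in> K"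
        "\<forall>x\<in>K. total_divergence p (sigma_rp_vec p w) x0 \<le> total_divergence p (sigma_rp_vec p w) x"
        using continuous_attains_inf[OF \<open>compact K\<close> False continuous_total_divergence[OF p(1)]] by metis
      have "x0 \<noteq> w" using x0 e by (auto simp: K_def)
      moreover have "sigma_rp_vec p w = sigma_rp_vec p x0 \<Longrightarrow> w = x0"
        using injD[OF sigma_rp_vec_inj, of p w x0] p by simp
      ultimately have "total_divergence p (sigma_rp_vec p w) x0 \<noteq> 0"
        using p by (auto simp: total_divergence_eq_0_iff)
      then show ?thesis
        using x0 total_divergence_nonneg[OF p(1), of "sigma_rp_vec p w" x0] by (metis less_le)
    qed (auto intro: exI[of _ 1])
    then obtain m where m: "0 < m" "\<And>x. x \<in> K \<Longrightarrow> m \<le> total_divergence p (sigma_rp_vec p w) x" by blast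
    obtain t0 where t0: "\<And>t. t0 \<le> t \<Longrightarrow> E t < min 1 m"
      using E_small[of "min 1 m"] m by auto
    have "dist (v t) w < e" if "t0 \<le> t" for t
    proof -
      have "v t \<notin> K" using t0[OF that] m(2)[of "v t"] by (auto simp: E_def)
      then show ?thesis using t0[OF that] by (auto simp: K_def E_def dist_commute)
    qed
    then show "\<forall>\<^sub>F t in at_top. dist (v t) w < e"
      unfolding eventually_at_top_linorder by blast
  qed
  moreover have "total_divergence p (sigma_rp_vec p w) w0 \<le> total_divergence p z w0"
    if z: "A *v z = y" for z
  proof (rule field_le_epsilon)
    fix e :: real assume "0 < e"
    then obtain t where t: "0 \<le> t" "E t < e" using E_small by blast
    have "total_divergence p z (v t) - E t
        = total_divergence p z w0 - total_divergence p (sigma_rp_vec p w) w0"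
      unfolding E_def by (rule divergence_difference_conserved[OF reg]) (use t z w in \<open>auto simp: int\<close>)
    then show "total_divergence p (sigma_rp_vec p w) w0 \<le> total_divergence p z w0 + e"
      using t total_divergence_nonneg[OF p(1), of z "v t"] by linarith
  qed
  ultimately show ?thesis using that w by blast
qed

end

section \<open>Minimal p-norm and the norm estimate\<close>

lemma sum_powr_eq_pnorm_powr:
  assumes "1 < p"
  shows "(\<Sum>i\<in>UNIV. \<bar>z $ i\<bar> powr p) = pnorm p z powr p"
  using assms by (simp add: pnorm_def powr_powr sum_nonneg)

lemma pnorm_attains_inf:
  fixes S :: "(real ^ 'n) set"
  assumes p: "1 < p" and S: "closed S" "S \<noteq> {}"
  obtains z where "z \<in> S" "\<And>x. x \<in> S \<Longrightarrow> pnorm p z \<le> pnorm p x"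
proof -
  obtain z0 where z0: "z0 \<in> S" using S by blast
  have cont: "continuous_on R (pnorm p :: real ^ 'n \<Rightarrow> real)" for R
  proof -
    have "continuous_on R (\<lambda>x :: real ^ 'n. \<bar>x $ i\<bar> powr p)" for i
      using p by (intro continuous_on_powr' continuous_intros continuous_on_component) simp_all
    then have "continuous_on R (\<lambda>x :: real ^ 'n. \<Sum>i\<in>UNIV. \<bar>x $ i\<bar> powr p)"
      by (intro continuous_on_sum)
    then show ?thesis
      unfolding pnorm_def using p by (intro continuous_on_powr') (simp_all add: sum_nonneg)
  qed
  have "norm x \<le> real CARD('n) powr (1 - 1 / p) * pnorm p x" for x :: "real ^ 'n"
    using norm_le_l1_cart[of x] sum_abs_le_powr[OF p, of x] by (simp add: pnorm_def)
  then have "norm x \<le> real CARD('n) powr (1 - 1 / p) * pnorm p z0"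
    if "pnorm p x \<le> pnorm p z0" for x :: "real ^ 'n"
    using mult_left_mono[OF that, of "real CARD('n) powr (1 - 1 / p)"] order_trans powr_ge_zero by blast
  then have "bounded {x :: real ^ 'n. pnorm p x \<le> pnorm p z0}"
    unfolding bounded_iff by blast
  moreover have "closed {x :: real ^ 'n. pnorm p x \<le> pnorm p z0}"
    by (intro closed_Collect_le cont continuous_on_const)
  ultimately have "compact (S \<inter> {x. pnorm p x \<le> pnorm p z0})"
    using S by (intro closed_Int_compact) (auto simp: compact_eq_bounded_closed)
  then obtain z where z: "z \<in> S" "pnorm p z \<le> pnorm p z0"
    "\<And>x. x \<in> S \<Longrightarrow> pnorm p x \<le> pnorm p z0 \<Longrightarrow> pnorm p z \<le> pnorm p x"
    using continuous_attains_inf[OF _ _ cont] z0 by (metis (no_types, lifting) Int_iff emptyE mem_Collect_eq order_refl)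
  show ?thesis
  proof
    show "pnorm p z \<le> pnorm p x" if "x \<in> S" for x
      using z(2,3) that by (cases "pnorm p x \<le> pnorm p z0") auto
  qed (rule z)
qed

lemma min_pnorm_attained:
  fixes A :: "real ^ 'n ^ 'm" and y :: "real ^ 'm"
  assumes p: "1 < p" and y: "y \<in> range (\<lambda>x. A *v x)"
    and zero: "\<And>z z'. L (z, z') = 0 \<longleftrightarrow> z = z'"
  obtains z where "A *v z = y" "pnorm p z = min_pnorm p A L y"
proof -
  have "closed {z. A *v z = y}"
    by (intro closed_Collect_eq continuous_on_const matrix_vector_mult_linear_continuous_on)
  moreover have "{z. A *v z = y} \<noteq> {}" using y by auto
  ultimately obtain z where z: "A *v z = y" "\<And>x. A *v x = y \<Longrightarrow> pnorm p z \<le> pnorm p x"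
    using pnorm_attains_inf[OF p, of "{z. A *v z = y}"] by auto
  have "min_pnorm p A L y = pnorm p z"
    unfolding min_pnorm_def using z by (intro Least_equality) (auto simp: zero)
  then show ?thesis using that z by simp
qed

text \<open>At the initial point all mirror coordinates equal \<open>\<alpha> powr (p - 1)\<close>, so up to a constant the divergence
from it is the \<open>p\<close>-th power of the norm perturbed by a small linear term.\<close>

lemma total_divergence_from_constant:
  fixes z :: "real ^ 'n"
  assumes p: "1 < p" and \<alpha>: "0 < \<alpha>"
  shows "total_divergence p z (\<chi> i. \<alpha> powr (p / 2))
    = pnorm p z powr p / p - \<alpha> powr (p - 1) * (\<Sum>i\<in>UNIV. z $ i) + real CARD('n) * ((1 - 1 / p) * (\<alpha> powr (p / 2))\<^sup>2)"
proof -
  have "signed_powr (2 - 2 / p) (\<alpha> powr (p / 2)) = \<alpha> powr (p - 1)"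
    using p \<alpha> by (simp add: signed_powr_pos powr_powr right_diff_distrib)
  then show ?thesis
    using p by (simp add: total_divergence_def rp_divergence_def sum.distrib sum_subtractf
        sum_divide_distrib[symmetric] sum_distrib_left[symmetric] sum_powr_eq_pnorm_powr)
qed

text \<open>With \<open>r = pnorm p u / pnorm p z\<close> and \<open>\<delta>\<close> the relative size of the linear term, Hoelder's inequality
turns the comparison of divergences into \<open>r powr p - 1 \<le> p * \<delta> * (r + 1)\<close>. The tangent inequality
replaces the left-hand side by \<open>p * (r - 1)\<close>, and then \<open>r \<le> (1 + \<delta>) / (1 - \<delta>)\<close>. The bound on \<open>\<alpha>\<close> is
what makes \<open>\<delta> \<le> 1 / 2\<close>, for which this quotient is at most \<open>1 + 4 * \<delta>\<close>.\<close>

lemma pnorm_estimate_of_divergence_le: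
  fixes u z :: "real ^ 'n"
  assumes p: "1 < p" and \<alpha>: "0 < \<alpha>"
    and le: "total_divergence p u (\<chi> i. \<alpha> powr (p / 2)) \<le> total_divergence p z (\<chi> i. \<alpha> powr (p / 2))"
    and small: "\<alpha> \<le> 1 / (2 powr (1 / (p - 1)) * real CARD('n) powr (1 / p)) * pnorm p z"
  shows "pnorm p u \<le> (1 + 4 * real CARD('n) powr (1 - 1 / p) * (\<alpha> / pnorm p z) powr (p - 1)) * pnorm p z"
proof -
  define N where "N = real CARD('n)"
  define \<mu> where "\<mu> = pnorm p z"
  define U where "U = pnorm p u"
  define K where "K = N powr (1 - 1 / p)"
  define \<delta> where "\<delta> = K * (\<alpha> / \<mu>) powr (p - 1)"
  define r where "r = U / \<mu>"
  have N: "0 < N" by (simp add: N_def)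
  \<comment> \<open>If \<open>\<mu>\<close> were zero, the smallness assumption would force \<open>\<alpha> \<le> 0\<close>.\<close>
  have \<mu>: "0 < \<mu>"
  proof (rule ccontr)
    assume "\<not> 0 < \<mu>"
    then have "\<mu> = 0" by (simp add: \<mu>_def pnorm_def not_less)
    with small \<alpha> show False by (simp add: \<mu>_def)
  qed
  have U: "0 \<le> U" by (simp add: U_def pnorm_def)
  have hoelder: "\<bar>\<Sum>i\<in>UNIV. x $ i\<bar> \<le> K * pnorm p x" for x :: "real ^ 'n"
    using sum_abs[of "\<lambda>i. x $ i" UNIV] sum_abs_le_powr[OF p, of x]
    unfolding K_def N_def pnorm_def by linarith
  have sums: "(\<Sum>i\<in>UNIV. u $ i) - (\<Sum>i\<in>UNIV. z $ i) \<le> K * (U + \<mu>)"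
    using hoelder[of u] hoelder[of z] unfolding U_def \<mu>_def distrib_left by linarith
  have "U powr p / p - \<mu> powr p / p \<le> \<alpha> powr (p - 1) * ((\<Sum>i\<in>UNIV. u $ i) - (\<Sum>i\<in>UNIV. z $ i))"
    using le unfolding total_divergence_from_constant[OF p \<alpha>] U_def \<mu>_def right_diff_distrib by linarith
  also have "\<dots> \<le> \<alpha> powr (p - 1) * (K * (U + \<mu>))"
    by (intro mult_left_mono sums) simp
  finally have "(U powr p / p - \<mu> powr p / p) * (p / \<mu> powr p)
      \<le> (\<alpha> powr (p - 1) * (K * (U + \<mu>))) * (p / \<mu> powr p)"
    using p by (intro mult_right_mono) auto
  moreover have "(U powr p / p - \<mu> powr p / p) * (p / \<mu> powr p) = r powr p - 1"
    using p \<mu> U by (simp add: r_def powr_divide left_diff_distrib diff_divide_distrib)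
  moreover have "(\<alpha> powr (p - 1) * (K * (U + \<mu>))) * (p / \<mu> powr p) = p * (\<delta> * (r + 1))"
  proof -
    have "\<mu> powr p = \<mu> powr (p - 1) * \<mu>" using \<mu> by (simp add: powr_diff)
    then show ?thesis using \<mu> \<alpha> by (simp add: \<delta>_def r_def powr_divide field_simps)
  qed
  moreover have "1 + p * (r - 1) \<le> r powr p"
    using abs_powr_tangent_at_one[OF p, of r] U \<mu> by (simp add: r_def)
  ultimately have "p * (r - 1) \<le> p * (\<delta> * (r + 1))" by linarith
  then have r: "r - 1 \<le> \<delta> * (r + 1)" using p by simp
  have \<delta>: "0 \<le> \<delta>" by (simp add: \<delta>_def K_def)
  have "\<alpha> / \<mu> \<le> 1 / (2 powr (1 / (p - 1)) * N powr (1 / p))"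
    using small \<mu> unfolding \<mu>_def[symmetric] N_def[symmetric] by (simp add: pos_divide_le_eq)
  then have "(\<alpha> / \<mu>) powr (p - 1) \<le> (1 / (2 powr (1 / (p - 1)) * N powr (1 / p))) powr (p - 1)"
    using p \<alpha> \<mu> by (intro powr_mono2) auto
  also have "\<dots> = 1 / (2 * N powr (1 - 1 / p))"
  proof -
    have "1 / p * (p - 1) = 1 - 1 / p" using p by (simp add: field_simps)
    then show ?thesis using p N by (simp add: powr_divide powr_mult powr_powr)
  qed
  finally have "\<delta> \<le> K * (1 / (2 * K))"
    unfolding \<delta>_def by (intro mult_left_mono) (auto simp: K_def)
  then have half: "\<delta> \<le> 1 / 2" using N by (simp add: K_def)
  have "r \<le> 1 + 4 * \<delta>"
  proof -
    have "(1 - \<delta>) * r \<le> 1 + \<delta>" using r by (simp add: algebra_simps)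
    also have "\<dots> \<le> (1 - \<delta>) * (1 + 4 * \<delta>)"
      using mult_left_mono[OF half \<delta>] by (simp add: algebra_simps)
    finally show ?thesis using half by simp
  qed
  then have "U \<le> (1 + 4 * \<delta>) * \<mu>" using \<mu> by (simp add: r_def pos_divide_le_eq)
  then show ?thesis by (simp add: U_def \<mu>_def \<delta>_def K_def N_def mult.assoc)
qed

theorem theorem1p4:
  fixes p \<alpha> :: real
    and A :: "real ^ 'n ^ 'm"
    and y :: "real ^ 'm"
    and L :: "(real ^ 'm) \<times> (real ^ 'm) \<Rightarrow> real"
    and T :: ereal
    and w :: "real \<Rightarrow> real ^ 'n"
    and w0 :: "real ^ 'n"
  assumes p: "1 < p" "p < 2"
    and y: "y \<in> range (\<lambda>x. A *v x)"
    and \<alpha>: "0 < \<alpha>"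
    and L_C1: "continuously_differentiable L"
    and L_convex: "\<And>z'. convex_on UNIV (\<lambda>z. L (z, z'))"
    and L_min: "\<And>z z'. 0 \<le> L (z, z')" "\<exists>z z'. L (z, z') = 0"
    and L_zero_iff: "\<And>z z'. L (z, z') = 0 \<longleftrightarrow> z = z'"
    and T: "0 < T"
    and w0: "w0 = inv (sigma_rp_vec p) (\<alpha> *\<^sub>R 1)"
    and w: "regular_solution p (rp_loss p A L y) w0 T w"
  shows "(T < \<infinity> \<longrightarrow> \<not> maximal_solution (rp_loss p A L y) w0 (real_of_ereal T) w) \<and>
    (\<forall>v. regular_solution p (rp_loss p A L y) w0 \<infinity> v \<and> (\<forall>t\<in>time_interval T. v t = w t) \<longrightarrow>
      (\<exists>w_inf. (v \<longlongrightarrow> w_inf) at_top \<and>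
        (\<forall>z. rp_loss p A L y w_inf \<le> rp_loss p A L y z) \<and>
        (\<alpha> \<le> 1 / (2 powr (1 / (p - 1)) * real CARD('n) powr (1 / p)) * min_pnorm p A L y \<longrightarrow>
          pnorm p (sigma_rp_vec p w_inf)
            \<le> (1 + 4 * real CARD('n) powr (1 - 1 / p) * (\<alpha> / min_pnorm p A L y) powr (p - 1))
               * min_pnorm p A L y)))"
proof -
  obtain g where g: "\<And>x. GDERIV (\<lambda>x. L (x, y)) x :> g x" "continuous_on UNIV g"
    using continuously_differentiable_partial_gradient[OF L_C1] by metis
  interpret reparametrized_loss p A y "\<lambda>x. L (x, y)" g
    by unfold_locales (use p y L_convex L_min(1) L_zero_iff g in auto)
  have loss: "rp_loss p A L y = loss"
    by (simp add: fun_eq_iff rp_loss_def loss_def)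
  have w0_eq: "w0 = (\<chi> i. \<alpha> powr (p / 2))"
    unfolding w0 using p \<alpha> by (simp add: inv_sigma_rp_vec signed_powr_pos)
  show ?thesis
    unfolding loss
  proof (intro conjI allI impI)
    assume "T < \<infinity>"
    then obtain r where "T = ereal r" "0 < r" using T by (cases T) auto
    then show "\<not> maximal_solution loss w0 (real_of_ereal T) w"
      using regular_solution_not_maximal w unfolding loss by simp
  next
    fix v assume "regular_solution p loss w0 \<infinity> v \<and> (\<forall>t\<in>time_interval T. v t = w t)"
    then obtain w_inf where w_inf: "(v \<longlongrightarrow> w_inf) at_top" "A *v sigma_rp_vec p w_inf = y"
      and closest: "\<And>z. A *v z = y \<Longrightarrow>
        total_divergence p (sigma_rp_vec p w_inf) w0 \<le> total_divergence p z w0"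
      using regular_solution_converges by blast
    obtain z where z: "A *v z = y" "pnorm p z = min_pnorm p A L y"
      using min_pnorm_attained[OF p(1) y L_zero_iff] by blast
    show "\<exists>w_inf. (v \<longlongrightarrow> w_inf) at_top \<and> (\<forall>z. loss w_inf \<le> loss z) \<and>
        (\<alpha> \<le> 1 / (2 powr (1 / (p - 1)) * real CARD('n) powr (1 / p)) * min_pnorm p A L y \<longrightarrow>
          pnorm p (sigma_rp_vec p w_inf)
            \<le> (1 + 4 * real CARD('n) powr (1 - 1 / p) * (\<alpha> / min_pnorm p A L y) powr (p - 1))
               * min_pnorm p A L y)"
    proof (intro exI conjI allI impI)
      show "(v \<longlongrightarrow> w_inf) at_top" by (rule w_inf)
      show "loss w_inf \<le> loss x" for x
        using loss_zero_iff[of w_inf] w_inf(2) by (simp add: loss_def l_nonneg)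
    qed (use pnorm_estimate_of_divergence_le[OF p(1) \<alpha> closest[OF z(1), unfolded w0_eq]] z in simp)
  qed
qed

end
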